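(* Suppose that $f:\mathbb{R}^n\to\overline{\mathbb{R}}$ is finite and locally lsc at $\bar x$. Let $h:=df(\bar x)$ and $W:=\{w\in\mathbb{R}^n\mid 0<h(w)<+\infty\}$. The following hold: (a) For each $w\in\mathbb{R}^n$ and $v\in\widehat\partial h(w)$, there exist $t_l\to0+$, $w_l\to w$ and $v_l\to v$ such that $v_l\in\widehat\partial f(\bar x+t_lw_l)$ for all $l$ and $h(w)=\lim_{l\to\infty}\frac{f(\bar x+t_lw_l)-f(\bar x)}{t_l}$. (b) If $h$ is proper (i.e. $h(0)=0$), then for any $\bar w\in W$, $$\partial h(\bar w)\subset\partial^{>}h(0)\subset\partial^{>}f(\bar x),$$ where $\partial^{>}h(0)=\operatorname{cl}\bigcup_{w\in W}\partial h(w)$ is nonempty if and only if $W\neq\emptyset$. (c) If $h$ is improper (i.e. $h(0)=-\infty$), the results in (b) hold with $\partial^{>}h_+(0)$ in place of $\partial^{>}h(0)$, where $h_+:=\max\{h,0\}$; that is, for any $\bar w\in W$, $\partial h(\bar w)\subset\partial^{>}h_+(0)\subset\partial^{>}f(\bar x)$, where $\partial^{>}h_+(0)=\operatorname{cl}\bigcup_{w\in W}\partial h(w)$ is nonempty if and only if $W\neq\emptyset$.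
   Context: $\overline{\mathbb{R}}=\mathbb{R}\cup\{\pm\infty\}$. A function $f$ finite at $\bar x$ is locally lsc at $\bar x$ if its epigraph is locally closed at $(\bar x,f(\bar x))$. Subderivative: $df(\bar x)(w):=\liminf_{t\downarrow0,\ w'\to w}\frac{f(\bar x+tw')-f(\bar x)}{t}$. Subgradients. Let $\varphi(x)$ be finite. $v\in\widehat\partial\varphi(x)$ (regular) if $\varphi(y)\ge\varphi(x)+\langle v,y-x\rangle+o(\|y-x\|)$. $v\in\partial\varphi(x)$ (limiting) if there are $x_k\to x$, $v_k\to v$ with $\varphi(x_k)\to\varphi(x)$ and $v_k\in\widehat\partial\varphi(x_k)$. $v\in\partial^{>}\varphi(x)$ (outer limiting) if there are $x_k\to x$, $v_k\to v$ with $\varphi(x_k)\to\varphi(x)$, $\varphi(x_k)>\varphi(x)$ and $v_k\in\partial\varphi(x_k)$. Subdifferentials are empty at points where $\varphi$ is not finite. *)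

theory Defs
  imports "HOL-Analysis.Analysis" "HOL-Library.Landau_Symbols"
begin

definition finite_at :: "('a \<Rightarrow> ereal) \<Rightarrow> 'a \<Rightarrow> bool" where
  "finite_at f x \<longleftrightarrow> \<bar>f x\<bar> \<noteq> \<infinity>"

definition proper :: "('a \<Rightarrow> ereal) \<Rightarrow> bool" where
  "proper f \<longleftrightarrow> (\<forall>x. f x \<noteq> -\<infinity>) \<and> (\<exists>x. f x \<noteq> \<infinity>)"

definition ereal_epigraph :: "('a \<Rightarrow> ereal) \<Rightarrow> ('a \<times> real) set" where
  "ereal_epigraph f = {(x, \<alpha>). f x \<le> ereal \<alpha>}"

definition locally_closed_at :: "'a::topological_space set \<Rightarrow> 'a \<Rightarrow> bool" where
  "locally_closed_at S p \<longleftrightarrow> (\<exists>V. closed V \<and> p \<in> interior V \<and> closed (S \<inter> V))"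

text \<open>Meaningful only where \<open>f x\<close> is finite.\<close>

definition locally_lsc_at :: "('a::topological_space \<Rightarrow> ereal) \<Rightarrow> 'a \<Rightarrow> bool" where
  "locally_lsc_at f x \<longleftrightarrow> locally_closed_at (ereal_epigraph f) (x, real_of_ereal (f x))"

definition diff_quotient ::
  "('a::real_normed_vector \<Rightarrow> ereal) \<Rightarrow> 'a \<Rightarrow> real \<Rightarrow> 'a \<Rightarrow> ereal" where
  "diff_quotient f x t w = (f (x + t *\<^sub>R w) - f x) / ereal t"

text \<open>The filter lets \<open>w'\<close> range over a full neighbourhood of \<open>w\<close>, including \<open>w' = w\<close>.\<close>

definition subderivative :: "('a::real_normed_vector \<Rightarrow> ereal) \<Rightarrow> 'a \<Rightarrow> 'a \<Rightarrow> ereal" where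
  "subderivative f x w =
     Liminf (at_right 0 \<times>\<^sub>F nhds w) (\<lambda>(t, w'). diff_quotient f x t w')"

text \<open>As usual for an expansion with a little-o term, the inequality is only required
  near \<open>x\<close>. The remainder \<open>r\<close> is real-valued, so \<open>\<phi> > -\<infinity>\<close> near \<open>x\<close> is implied.\<close>

definition regular_subdiff :: "('a::real_inner \<Rightarrow> ereal) \<Rightarrow> 'a \<Rightarrow> 'a set" where
  "regular_subdiff \<phi> x =
     {v. finite_at \<phi> x \<and>
         (\<exists>r :: 'a \<Rightarrow> real. r \<in> o[at x](\<lambda>y. norm (y - x)) \<and>
            (\<forall>\<^sub>F y in at x. \<phi> y \<ge> \<phi> x + ereal (v \<bullet> (y - x)) + ereal (r y)))}"

definition limiting_subdiff :: "('a::real_inner \<Rightarrow> ereal) \<Rightarrow> 'a \<Rightarrow> 'a set" where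
  "limiting_subdiff \<phi> x =
     {v. finite_at \<phi> x \<and>
         (\<exists>xs vs :: nat \<Rightarrow> 'a. xs \<longlonglongrightarrow> x \<and> vs \<longlonglongrightarrow> v \<and> (\<lambda>k. \<phi> (xs k)) \<longlonglongrightarrow> \<phi> x \<and>
            (\<forall>k. vs k \<in> regular_subdiff \<phi> (xs k)))}"

definition outer_subdiff :: "('a::real_inner \<Rightarrow> ereal) \<Rightarrow> 'a \<Rightarrow> 'a set" where
  "outer_subdiff \<phi> x =
     {v. finite_at \<phi> x \<and>
         (\<exists>xs vs :: nat \<Rightarrow> 'a. xs \<longlonglongrightarrow> x \<and> vs \<longlonglongrightarrow> v \<and> (\<lambda>k. \<phi> (xs k)) \<longlonglongrightarrow> \<phi> x \<and>
            (\<forall>k. \<phi> (xs k) > \<phi> x \<and> vs k \<in> limiting_subdiff \<phi> (xs k)))}"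

end

theory Submission
  imports Defs
begin

text \<open>
  The subderivative \<open>h\<close> of \<open>f\<close> at \<open>x\<close> is the lower epigraphical limit, as \<open>t\<close> decreases to \<open>0\<close>,
  of the difference quotients \<open>u \<mapsto> (f (x + t u) - f x) / t\<close>. A regular subgradient of such a
  quotient at \<open>u\<close> is one of \<open>f\<close> at \<open>x + t u\<close>, because the two functions differ by an affine change
  of the variable and of the value that multiplies slopes by one. So part (a) says that regular
  subgradients of an epigraphical limit are limits of regular subgradients of the approximating
  functions, attained at nearby points with nearby values.

  For part (a), let \<open>v\<close> be a regular subgradient of \<open>h\<close> at \<open>w\<close>. The quotient with small \<open>t\<close>,
  tilted by \<open>- v \<bullet> (u - w)\<close> and penalized by a multiple of \<open>\<bar>u - w\<bar>\<^sup>2\<close>, is minimized over a small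
  closed ball around \<open>w\<close>. The subgradient inequality of \<open>h\<close> passes, up to a small error, to all
  quotients with small \<open>t\<close> uniformly on the ball, since the ball is compact; the definition of \<open>h w\<close>
  as a lower limit gives a point where the tilted quotient is almost \<open>h w\<close>. Balanced against a
  suitable penalty these two facts keep the minimizer inside the ball and make the gradient of the
  penalty there small, so that a regular subgradient close to \<open>v\<close> appears
  (\<open>perturbed_regular_subgradient\<close>). Local closedness of the epigraph of \<open>f\<close> provides the compactness
  by which the minimum is attained (\<open>compact_epigraph_diff_quotient\<close>).

  For parts (b) and (c), \<open>h\<close> is lower semicontinuous and positively homogeneous of degree one, so
  \<open>h 0\<close> is \<open>0\<close> or \<open>-\<infinity>\<close>, and \<open>h\<close> has the same limiting subgradients at all points of the ray through
  \<open>w\<close>. Sliding towards \<open>0\<close> along that ray makes a limiting subgradient of \<open>h\<close> at \<open>w \<in> W\<close> an outer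
  one at \<open>0\<close>. Conversely, the points that enter an outer subgradient at \<open>0\<close> are in \<open>W\<close>. Since outer
  subdifferentials are closed, this identifies the outer subdifferential at \<open>0\<close> with the closure of
  the union over \<open>W\<close>. Part (a), applied at a point of \<open>W\<close>, where the limit of the quotients is
  positive and hence \<open>f (x + t u) > f x\<close>, gives the inclusion in the outer subdifferential of \<open>f\<close>.
  Finally \<open>W\<close> is open relative to the domain of \<open>h\<close> and penalized minimization of \<open>h\<close> itself
  shows that regular subgradients exist near each of its points. The argument uses only
  the values of \<open>h\<close> where they are positive, so it holds for \<open>h\<close> when \<open>h 0 = 0\<close> and
  for the positive part of \<open>h\<close> always (\<open>outer_subdiff_eq_closure_limiting_subdiff\<close>).
\<close>

section \<open>Subdifferentials by \<open>\<epsilon>\<close>-approximation\<close>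

text \<open>
  The remainder function is exchanged for one inequality per slope error \<open>e\<close>. In the converse
  direction the remainder of least absolute value is the negative part of the defect; where
  \<open>\<phi>\<close> is \<open>\<infinity>\<close> this is \<open>0\<close>, which has to be said explicitly because \<open>real_of_ereal\<close> maps \<open>\<infinity>\<close> to \<open>0\<close>.
\<close>

lemma regular_subdiff_iff:
  fixes \<phi> :: "'a::real_inner \<Rightarrow> ereal"
  shows "v \<in> regular_subdiff \<phi> x \<longleftrightarrow>
    finite_at \<phi> x \<and>
    (\<forall>e>0. \<forall>\<^sub>F y in nhds x. \<phi> x + ereal (v \<bullet> (y - x) - e * norm (y - x)) \<le> \<phi> y)"
    (is "_ \<longleftrightarrow> _ \<and> ?R")
proof (cases "finite_at \<phi> x")
  case False
  then show ?thesis by (simp add: regular_subdiff_def)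
next
  case True
  then obtain c where c: "\<phi> x = ereal c" by (auto simp: finite_at_def)
  have nhds_at: "(\<forall>\<^sub>F y in nhds x. \<phi> x + ereal (v \<bullet> (y - x) - e * norm (y - x)) \<le> \<phi> y)
      \<longleftrightarrow> (\<forall>\<^sub>F y in at x. \<phi> x + ereal (v \<bullet> (y - x) - e * norm (y - x)) \<le> \<phi> y)" for e
    by (subst eventually_nhds_conv_at) (simp add: c)
  have "v \<in> regular_subdiff \<phi> x \<longleftrightarrow> ?R"
  proof
    assume "v \<in> regular_subdiff \<phi> x"
    then obtain r :: "'a \<Rightarrow> real" where r: "r \<in> o[at x](\<lambda>y. norm (y - x))"
      and ev: "\<forall>\<^sub>F y in at x. \<phi> x + ereal (v \<bullet> (y - x)) + ereal (r y) \<le> \<phi> y"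
      by (auto simp: regular_subdiff_def)
    show ?R
    proof (intro allI impI)
      fix e :: real assume "e > 0"
      with r have "\<forall>\<^sub>F y in at x. norm (r y) \<le> e * norm (norm (y - x))"
        by (rule landau_o.smallD)
      with ev have "\<forall>\<^sub>F y in at x. \<phi> x + ereal (v \<bullet> (y - x) - e * norm (y - x)) \<le> \<phi> y"
      proof eventually_elim
        case (elim y)
        have "\<phi> x + ereal (v \<bullet> (y - x) - e * norm (y - x))
            \<le> \<phi> x + ereal (v \<bullet> (y - x)) + ereal (r y)"
          using elim(2) by (auto simp: c)
        with elim(1) show ?case by (rule order_trans[rotated])
      qed
      then show "\<forall>\<^sub>F y in nhds x. \<phi> x + ereal (v \<bullet> (y - x) - e * norm (y - x)) \<le> \<phi> y"
        by (simp only: nhds_at)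
    qed
  next
    assume R: ?R
    define r where "r y = (if \<phi> y = \<infinity> then 0
        else min 0 (real_of_ereal (\<phi> y) - c - v \<bullet> (y - x)))" for y
    have no_minus_inf: "\<forall>\<^sub>F y in at x. \<phi> y \<noteq> -\<infinity>"
      using R[rule_format, of 1] unfolding nhds_at
      by (auto elim!: eventually_mono simp: c)
    have "r \<in> o[at x](\<lambda>y. norm (y - x))"
    proof (rule landau_o.smallI)
      fix e :: real assume "e > 0"
      with R have "\<forall>\<^sub>F y in at x. \<phi> x + ereal (v \<bullet> (y - x) - e * norm (y - x)) \<le> \<phi> y"
        unfolding nhds_at by blast
      then show "\<forall>\<^sub>F y in at x. norm (r y) \<le> e * norm (norm (y - x))"
      proof eventually_elim
        case (elim y)
        then show ?case using \<open>e > 0\<close>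
          by (cases "\<phi> y") (auto simp: r_def c min_def)
      qed
    qed
    moreover have "\<forall>\<^sub>F y in at x. \<phi> x + ereal (v \<bullet> (y - x)) + ereal (r y) \<le> \<phi> y"
      using no_minus_inf
    proof eventually_elim
      case (elim y)
      then show ?case by (cases "\<phi> y") (auto simp: r_def c min_def simp del: ereal_min)
    qed
    ultimately show "v \<in> regular_subdiff \<phi> x"
      using True by (auto simp: regular_subdiff_def)
  qed
  with True show ?thesis by simp
qed

lemma finite_at_regular_subdiff: "v \<in> regular_subdiff \<phi> x \<Longrightarrow> finite_at \<phi> x"
  by (simp add: regular_subdiff_def)

lemma regular_subdiff_cong:
  fixes \<phi> :: "'a::real_inner \<Rightarrow> ereal"
  assumes "\<forall>\<^sub>F y in nhds x. \<phi> y = \<psi> y"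
  shows "regular_subdiff \<phi> x = regular_subdiff \<psi> x"
proof -
  have x: "\<phi> x = \<psi> x" using assms by (rule eventually_nhds_x_imp_x)
  have "(\<forall>\<^sub>F y in nhds x. \<phi> x + ereal (v \<bullet> (y - x) - e * norm (y - x)) \<le> \<phi> y) \<longleftrightarrow>
        (\<forall>\<^sub>F y in nhds x. \<psi> x + ereal (v \<bullet> (y - x) - e * norm (y - x)) \<le> \<psi> y)" for e v
    by (rule eventually_cong[OF assms]) (simp add: x)
  then show ?thesis
    by (auto simp: regular_subdiff_iff finite_at_def x)
qed

lemma rescale_le_iff:
  assumes "(t::real) > 0"
  shows "(A - ereal c) / ereal t \<le> ereal \<alpha> \<longleftrightarrow> A \<le> ereal (c + t * \<alpha>)"
    and "ereal \<alpha> \<le> (A - ereal c) / ereal t \<longleftrightarrow> ereal (c + t * \<alpha>) \<le> A"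
  using assms by (cases A; auto simp: field_simps)+

text \<open>
  Rescaling the variable and the value by the same factor leaves slopes unchanged. This
  transports subgradients from a difference quotient to \<open>f\<close>, and along the rays of a positively
  homogeneous function.
\<close>

lemma regular_subdiff_rescale:
  fixes \<phi> :: "'a::real_inner \<Rightarrow> ereal"
  assumes v: "v \<in> regular_subdiff (\<lambda>u. (\<phi> (x + t *\<^sub>R u) - ereal c) / ereal t) u" and t: "t > 0"
  shows "v \<in> regular_subdiff \<phi> (x + t *\<^sub>R u)"
proof -
  define \<psi> where "\<psi> u = (\<phi> (x + t *\<^sub>R u) - ereal c) / ereal t" for u
  have v: "finite_at \<psi> u"
    "\<And>e. e > 0 \<Longrightarrow> \<forall>\<^sub>F y in nhds u. \<psi> u + ereal (v \<bullet> (y - u) - e * norm (y - u)) \<le> \<psi> y"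
    using v by (auto simp: regular_subdiff_iff \<psi>_def[abs_def])
  then obtain b where b: "\<phi> (x + t *\<^sub>R u) = ereal b"
    using t by (cases "\<phi> (x + t *\<^sub>R u)") (auto simp: \<psi>_def finite_at_def)
  have \<psi>u: "\<psi> u = ereal ((b - c) / t)" using t by (simp add: \<psi>_def b)
  have lim: "((\<lambda>y. (1 / t) *\<^sub>R (y - x)) \<longlongrightarrow> (1 / t) *\<^sub>R ((x + t *\<^sub>R u) - x)) (nhds (x + t *\<^sub>R u))"
    by (intro tendsto_intros filterlim_ident)
  show ?thesis
    unfolding regular_subdiff_iff
  proof (intro conjI allI impI)
    show "finite_at \<phi> (x + t *\<^sub>R u)" by (simp add: finite_at_def b)
    fix e :: real assume e: "e > 0"
    have "\<forall>\<^sub>F y in nhds (x + t *\<^sub>R u). \<psi> u + ereal (v \<bullet> ((1 / t) *\<^sub>R (y - x) - u)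
            - e * norm ((1 / t) *\<^sub>R (y - x) - u)) \<le> \<psi> ((1 / t) *\<^sub>R (y - x))"
      by (rule eventually_compose_filterlim[OF v(2)[OF e]]) (use lim t in simp)
    then show "\<forall>\<^sub>F y in nhds (x + t *\<^sub>R u).
        \<phi> (x + t *\<^sub>R u) + ereal (v \<bullet> (y - (x + t *\<^sub>R u)) - e * norm (y - (x + t *\<^sub>R u))) \<le> \<phi> y"
    proof eventually_elim
      case (elim y)
      have d: "(1 / t) *\<^sub>R (y - x) - u = (1 / t) *\<^sub>R (y - (x + t *\<^sub>R u))"
        using t by (simp add: algebra_simps)
      have "\<phi> (x + t *\<^sub>R ((1 / t) *\<^sub>R (y - x))) = \<phi> y" using t by simp
      with elim have "ereal ((b - c) / t + (v \<bullet> (y - (x + t *\<^sub>R u)) - e * norm (y - (x + t *\<^sub>R u))) / t)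
            \<le> (\<phi> y - ereal c) / ereal t"
        using t unfolding d by (simp add: \<psi>u \<psi>_def[of "(1 / t) *\<^sub>R (y - x)"] diff_divide_distrib)
      moreover have "c + t * ((b - c) / t + (v \<bullet> (y - (x + t *\<^sub>R u)) - e * norm (y - (x + t *\<^sub>R u))) / t)
          = b + (v \<bullet> (y - (x + t *\<^sub>R u)) - e * norm (y - (x + t *\<^sub>R u)))"
        using t by (simp add: distrib_left)
      ultimately show ?case
        unfolding rescale_le_iff(2)[OF t] b by simp
    qed
  qed
qed

lemma tendsto_ereal_squeeze:
  assumes "\<bar>a\<bar> \<noteq> \<infinity>"
    and "\<And>k. a - ereal (1 / Suc k) < f k" "\<And>k. f k < a + ereal (1 / Suc k)"
  shows "f \<longlonglongrightarrow> (a::ereal)"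
proof -
  obtain r where r: "a = ereal r" using assms(1) by auto
  have "(\<lambda>k. 1 / real (Suc k)) \<longlonglongrightarrow> 0"
    by (rule LIMSEQ_inverse_real_of_nat[unfolded inverse_eq_divide])
  from tendsto_diff[OF tendsto_const[of r] this] tendsto_add[OF tendsto_const[of r] this]
  have lim: "(\<lambda>k. a - ereal (1 / Suc k)) \<longlonglongrightarrow> a" "(\<lambda>k. a + ereal (1 / Suc k)) \<longlonglongrightarrow> a"
    by (simp_all add: r del: of_nat_Suc)
  show ?thesis
    using assms(2,3) by (intro tendsto_sandwich[OF _ _ lim] always_eventually allI) (auto intro: less_imp_le)
qed

lemma tendsto_dist_squeeze:
  assumes "\<And>k. dist (f k) a < 1 / Suc k"
  shows "f \<longlonglongrightarrow> a"
proof -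
  have l: "(\<lambda>k. 1 / real (Suc k)) \<longlonglongrightarrow> 0"
    by (rule LIMSEQ_inverse_real_of_nat[unfolded inverse_eq_divide])
  have "(\<lambda>k. dist (f k) a) \<longlonglongrightarrow> 0"
    by (intro tendsto_sandwich[OF _ _ tendsto_const l] always_eventually allI zero_le_dist)
      (rule less_imp_le[OF assms])
  then show ?thesis by (rule tendsto_dist_iff[THEN iffD2])
qed

text \<open>
  Limiting and outer subgradients are both defined by sequences that converge together with the
  function values. Replacing them once and for all by \<open>\<epsilon>\<close>-approximations makes nested limits
  accessible to the triangle inequality, with no diagonal sequences.
\<close>

lemma attentive_sequence_iff:
  fixes \<phi> :: "'a::metric_space \<Rightarrow> ereal"
  assumes "finite_at \<phi> x"
  shows "(\<exists>xs vs :: nat \<Rightarrow> 'a. xs \<longlonglongrightarrow> x \<and> vs \<longlonglongrightarrow> v \<and> (\<lambda>k. \<phi> (xs k)) \<longlonglongrightarrow> \<phi> x \<and> (\<forall>k. P (xs k) (vs k)))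
    \<longleftrightarrow> (\<forall>e>0. \<exists>y u. dist y x < e \<and> dist u v < e \<and> \<phi> x - ereal e < \<phi> y \<and> \<phi> y < \<phi> x + ereal e \<and> P y u)"
    (is "?L \<longleftrightarrow> ?R")
proof
  obtain c where c: "\<phi> x = ereal c" using assms by (auto simp: finite_at_def)
  show ?R if ?L
  proof (intro allI impI)
    fix e :: real assume e: "e > 0"
    from that obtain xs vs where s: "xs \<longlonglongrightarrow> x" "vs \<longlonglongrightarrow> v" "(\<lambda>k. \<phi> (xs k)) \<longlonglongrightarrow> \<phi> x" "\<forall>k. P (xs k) (vs k)"
      by blast
    have "\<forall>\<^sub>F k in sequentially. dist (xs k) x < e \<and> dist (vs k) v < e \<and>
        \<phi> x - ereal e < \<phi> (xs k) \<and> \<phi> (xs k) < \<phi> x + ereal e"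
      using tendstoD[OF s(1) e] tendstoD[OF s(2) e]
        order_tendstoD(1)[OF s(3), of "\<phi> x - ereal e"] order_tendstoD(2)[OF s(3), of "\<phi> x + ereal e"] e
      by (simp add: c eventually_conj_iff)
    then obtain k where "dist (xs k) x < e \<and> dist (vs k) v < e \<and>
        \<phi> x - ereal e < \<phi> (xs k) \<and> \<phi> (xs k) < \<phi> x + ereal e"
      by (auto simp: eventually_sequentially)
    with s(4) show "\<exists>y u. dist y x < e \<and> dist u v < e \<and> \<phi> x - ereal e < \<phi> y \<and> \<phi> y < \<phi> x + ereal e \<and> P y u"
      by blast
  qed
  show ?L if R: ?R
  proof -
    have "\<exists>z. dist (fst z) x < 1 / real (Suc k) \<and> dist (snd z) v < 1 / real (Suc k) \<and>
        \<phi> x - ereal (1 / real (Suc k)) < \<phi> (fst z) \<and> \<phi> (fst z) < \<phi> x + ereal (1 / real (Suc k)) \<and>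
        P (fst z) (snd z)" for k
    proof -
      have "0 < 1 / real (Suc k)" by simp
      from R[rule_format, OF this] show ?thesis by auto
    qed
    then obtain z where s: "\<And>k. dist (fst (z k)) x < 1 / real (Suc k)"
      "\<And>k. dist (snd (z k)) v < 1 / real (Suc k)"
      "\<And>k. \<phi> x - ereal (1 / real (Suc k)) < \<phi> (fst (z k))"
      "\<And>k. \<phi> (fst (z k)) < \<phi> x + ereal (1 / real (Suc k))"
      "\<And>k. P (fst (z k)) (snd (z k))"
      by metis
    define xs vs where "xs k = fst (z k)" and "vs k = snd (z k)" for k
    note s = s[folded xs_def vs_def]
    have "xs \<longlonglongrightarrow> x" by (rule tendsto_dist_squeeze) (rule s)
    moreover have "vs \<longlonglongrightarrow> v" by (rule tendsto_dist_squeeze) (rule s)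
    moreover have "(\<lambda>k. \<phi> (xs k)) \<longlonglongrightarrow> \<phi> x"
      by (rule tendsto_ereal_squeeze) (use assms in \<open>simp add: finite_at_def\<close>, (rule s)+)
    ultimately show ?L using s(5) by blast
  qed
qed

lemma limiting_subdiff_iff:
  "v \<in> limiting_subdiff \<phi> x \<longleftrightarrow> finite_at \<phi> x \<and>
    (\<forall>e>0. \<exists>y u. dist y x < e \<and> dist u v < e \<and> \<phi> x - ereal e < \<phi> y \<and> \<phi> y < \<phi> x + ereal e \<and>
       u \<in> regular_subdiff \<phi> y)"
  unfolding limiting_subdiff_def mem_Collect_eq
  by (rule conj_cong[OF refl]) (rule attentive_sequence_iff)

lemma finite_at_limiting_subdiff: "v \<in> limiting_subdiff \<phi> x \<Longrightarrow> finite_at \<phi> x"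
  by (simp add: limiting_subdiff_def)

lemma regular_subset_limiting: "regular_subdiff \<phi> x \<subseteq> limiting_subdiff \<phi> x"
proof
  fix v assume v: "v \<in> regular_subdiff \<phi> x"
  then have fin: "finite_at \<phi> x" by (rule finite_at_regular_subdiff)
  then obtain c where "\<phi> x = ereal c" by (auto simp: finite_at_def)
  then have "\<phi> x - ereal e < \<phi> x" "\<phi> x < \<phi> x + ereal e" if "e > 0" for e
    using that by simp_all
  with v fin show "v \<in> limiting_subdiff \<phi> x"
    unfolding limiting_subdiff_iff by (metis dist_self)
qed

text \<open>
  Functions that agree on a neighbourhood of \<open>x\<close> agree on a neighbourhood of every point near \<open>x\<close>,
  so their regular subdifferentials coincide at the approximating points.
\<close>

lemma limiting_subdiff_cong:
  assumes ev: "\<forall>\<^sub>F y in nhds x. \<phi> y = \<psi> y"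
  shows "limiting_subdiff \<phi> x = limiting_subdiff \<psi> x"
proof -
  have "limiting_subdiff \<phi> x \<subseteq> limiting_subdiff \<psi> x" if ev: "\<forall>\<^sub>F y in nhds x. \<phi> y = \<psi> y" for \<phi> \<psi> :: "'a \<Rightarrow> ereal"
  proof
    fix v assume v: "v \<in> limiting_subdiff \<phi> x"
    have x: "\<phi> x = \<psi> x" using ev by (rule eventually_nhds_x_imp_x)
    have "\<forall>\<^sub>F y in nhds x. \<forall>\<^sub>F z in nhds y. \<phi> z = \<psi> z"
      using ev by (simp add: eventually_eventually)
    then obtain d where d: "d > 0" "\<And>y. dist y x < d \<Longrightarrow> \<forall>\<^sub>F z in nhds y. \<phi> z = \<psi> z"
      by (auto simp: eventually_nhds_metric)
    show "v \<in> limiting_subdiff \<psi> x"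
      unfolding limiting_subdiff_iff
    proof (intro conjI allI impI)
      show "finite_at \<psi> x" using v x by (auto simp: limiting_subdiff_iff finite_at_def)
      fix e :: real assume e: "e > 0"
      define e' where "e' = min d e"
      have e': "e' > 0" "e' \<le> e" "e' \<le> d" using d e by (auto simp: e'_def)
      obtain y u where yu: "dist y x < e'" "dist u v < e'" "\<phi> x - ereal e' < \<phi> y" "\<phi> y < \<phi> x + ereal e'"
        "u \<in> regular_subdiff \<phi> y"
        using v e' unfolding limiting_subdiff_iff by blast
      have ev: "\<forall>\<^sub>F z in nhds y. \<phi> z = \<psi> z" using yu(1) e' d by simp
      then have y: "\<phi> y = \<psi> y" by (rule eventually_nhds_x_imp_x)
      have "\<psi> x - ereal e \<le> \<psi> x - ereal e'" "\<psi> x + ereal e' \<le> \<psi> x + ereal e"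
        using e' by (auto intro: ereal_minus_mono add_mono)
      then have "\<psi> x - ereal e < \<psi> y" "\<psi> y < \<psi> x + ereal e"
        using yu(3,4) unfolding x y by order+
      moreover have "u \<in> regular_subdiff \<psi> y"
        using yu(5) regular_subdiff_cong[OF ev] by simp
      ultimately show "\<exists>y u. dist y x < e \<and> dist u v < e \<and> \<psi> x - ereal e < \<psi> y \<and> \<psi> y < \<psi> x + ereal e \<and>
          u \<in> regular_subdiff \<psi> y"
        using yu(1,2) e' by (intro exI[of _ y] exI[of _ u]) auto
    qed
  qed
  moreover have "\<forall>\<^sub>F y in nhds x. \<psi> y = \<phi> y" using ev by (rule eventually_mono) simp
  ultimately show ?thesis using ev by (metis subset_antisym)
qed

text \<open>
  The definition approximates by limiting subgradients; regular ones suffice. A limiting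
  subgradient at \<open>y\<close> comes from regular ones at points with values close to \<open>\<phi> y\<close>, and these
  values exceed \<open>\<phi> x\<close> as soon as they are within \<open>\<phi> y - \<phi> x\<close> of \<open>\<phi> y\<close>.
\<close>

lemma outer_subdiff_iff:
  "v \<in> outer_subdiff \<phi> x \<longleftrightarrow> finite_at \<phi> x \<and>
    (\<forall>e>0. \<exists>y u. dist y x < e \<and> dist u v < e \<and> \<phi> x < \<phi> y \<and> \<phi> y < \<phi> x + ereal e \<and>
       u \<in> regular_subdiff \<phi> y)"
proof (cases "finite_at \<phi> x")
  case False
  then show ?thesis by (simp add: outer_subdiff_def)
next
  case True
  then obtain c where c: "\<phi> x = ereal c" by (auto simp: finite_at_def)
  have "v \<in> outer_subdiff \<phi> x \<longleftrightarrow> (\<forall>e>0. \<exists>y u. dist y x < e \<and> dist u v < e \<and>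
      \<phi> x - ereal e < \<phi> y \<and> \<phi> y < \<phi> x + ereal e \<and> \<phi> x < \<phi> y \<and> u \<in> limiting_subdiff \<phi> y)"
    unfolding outer_subdiff_def mem_Collect_eq
    using attentive_sequence_iff[OF True, of v "\<lambda>y u. \<phi> x < \<phi> y \<and> u \<in> limiting_subdiff \<phi> y"] True
    by (simp only: simp_thms)
  also have "\<dots> \<longleftrightarrow> (\<forall>e>0. \<exists>y u. dist y x < e \<and> dist u v < e \<and> \<phi> x < \<phi> y \<and> \<phi> y < \<phi> x + ereal e \<and>
       u \<in> regular_subdiff \<phi> y)" (is "?L \<longleftrightarrow> ?R")
  proof
    assume L: ?L
    show ?R
    proof (intro allI impI)
      fix e :: real assume e: "e > 0"
      from L[rule_format, OF half_gt_zero[OF e]] obtain y u where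
        y: "dist y x < e / 2" "dist u v < e / 2" "\<phi> y < \<phi> x + ereal (e / 2)" "\<phi> x < \<phi> y"
          "u \<in> limiting_subdiff \<phi> y"
        by blast
      obtain b where b: "\<phi> y = ereal b"
        using finite_at_limiting_subdiff[OF y(5)] by (auto simp: finite_at_def)
      define e' where "e' = min (e / 2) (b - c)"
      have e': "e' > 0" "e' \<le> e / 2" "e' \<le> b - c" using e y(4) by (auto simp: e'_def b c min_def)
      obtain z q where z: "dist z y < e'" "dist q u < e'" "\<phi> y - ereal e' < \<phi> z" "\<phi> z < \<phi> y + ereal e'"
          "q \<in> regular_subdiff \<phi> z"
        using y(5) e' unfolding limiting_subdiff_iff by blast
      have "dist z x < e" using dist_triangle[of z x y] z y e' by linarith
      moreover have "dist q v < e" using dist_triangle[of q v u] z y e' by linarith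
      moreover have "\<phi> x < \<phi> z"
        using z(3) e' by (cases "\<phi> z") (auto simp: b c)
      moreover have "\<phi> z < \<phi> x + ereal e"
        using z(4) y(3) e' by (cases "\<phi> z") (auto simp: b c)
      ultimately show "\<exists>y u. dist y x < e \<and> dist u v < e \<and> \<phi> x < \<phi> y \<and> \<phi> y < \<phi> x + ereal e \<and>
          u \<in> regular_subdiff \<phi> y"
        using z(5) by blast
    qed
  next
    assume R: ?R
    show ?L
    proof (intro allI impI)
      fix e :: real assume e: "e > 0"
      with R obtain y u where y: "dist y x < e" "dist u v < e" "\<phi> x < \<phi> y" "\<phi> y < \<phi> x + ereal e"
        "u \<in> regular_subdiff \<phi> y" by blast
      moreover have "\<phi> x - ereal e < \<phi> y" using y(3) e by (cases "\<phi> y") (auto simp: c)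
      ultimately show "\<exists>y u. dist y x < e \<and> dist u v < e \<and>
        \<phi> x - ereal e < \<phi> y \<and> \<phi> y < \<phi> x + ereal e \<and> \<phi> x < \<phi> y \<and> u \<in> limiting_subdiff \<phi> y"
        using regular_subset_limiting by blast
    qed
  qed
  finally show ?thesis using True by simp
qed

lemma closed_outer_subdiff: "closed (outer_subdiff \<phi> x)"
proof -
  have "v \<in> outer_subdiff \<phi> x" if v: "v \<in> closure (outer_subdiff \<phi> x)" for v
  proof -
    have ap: "\<exists>q\<in>outer_subdiff \<phi> x. dist q v < e" if "e > 0" for e
      using v that by (auto simp: closure_approachable)
    show ?thesis
      unfolding outer_subdiff_iff
    proof (intro conjI allI impI)
      show "finite_at \<phi> x" using ap[of 1] by (auto simp: outer_subdiff_iff)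
      fix e :: real assume e: "e > 0"
      obtain q where q: "q \<in> outer_subdiff \<phi> x" "dist q v < e / 2" using ap[of "e / 2"] e by auto
      obtain y u where y: "dist y x < e / 2" "dist u q < e / 2" "\<phi> x < \<phi> y" "\<phi> y < \<phi> x + ereal (e / 2)"
        "u \<in> regular_subdiff \<phi> y"
        using q(1) half_gt_zero[OF e] unfolding outer_subdiff_iff by blast
      have "dist u v < e" using dist_triangle[of u v q] q y by linarith
      moreover have "\<phi> y < \<phi> x + ereal e"
      proof -
        have "\<phi> x + ereal (e / 2) \<le> \<phi> x + ereal e" using e by (auto intro: add_mono)
        with y(4) show ?thesis by order
      qed
      moreover have "dist y x < e" using y(1) e by simp
      ultimately show "\<exists>y u. dist y x < e \<and> dist u v < e \<and> \<phi> x < \<phi> y \<and> \<phi> y < \<phi> x + ereal e \<and>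
          u \<in> regular_subdiff \<phi> y"
        using y by blast
    qed
  qed
  then show ?thesis by (meson closure_subset_eq subsetI)
qed

section \<open>The subderivative as a lower limit\<close>

lemma eventually_at_right_times_nhds:
  fixes w :: "'a::metric_space"
  shows "(\<forall>\<^sub>F z in at_right (0::real) \<times>\<^sub>F nhds w. P z) \<longleftrightarrow>
    (\<exists>d>0. \<forall>t u. 0 < t \<and> t < d \<and> dist u w < d \<longrightarrow> P (t, u))"
proof
  assume "\<forall>\<^sub>F z in at_right (0::real) \<times>\<^sub>F nhds w. P z"
  then obtain Q R where Q: "\<forall>\<^sub>F t in at_right (0::real). Q t" and R: "\<forall>\<^sub>F u in nhds w. R u"
    and P: "\<And>t u. Q t \<Longrightarrow> R u \<Longrightarrow> P (t, u)"
    by (auto simp: eventually_prod_filter)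
  obtain a where a: "a > 0" "\<And>t. 0 < t \<Longrightarrow> t < a \<Longrightarrow> Q t"
    using Q by (auto simp: eventually_at_right_field)
  obtain b where b: "b > 0" "\<And>u. dist u w < b \<Longrightarrow> R u"
    using R by (auto simp: eventually_nhds_metric)
  show "\<exists>d>0. \<forall>t u. 0 < t \<and> t < d \<and> dist u w < d \<longrightarrow> P (t, u)"
    using a b P by (intro exI[of _ "min a b"]) auto
next
  assume "\<exists>d>0. \<forall>t u. 0 < t \<and> t < d \<and> dist u w < d \<longrightarrow> P (t, u)"
  then obtain d where d: "d > 0" "\<And>t u. 0 < t \<Longrightarrow> t < d \<Longrightarrow> dist u w < d \<Longrightarrow> P (t, u)" by blast
  have "\<forall>\<^sub>F t in at_right (0::real). 0 < t \<and> t < d"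
    using d(1) by (auto simp: eventually_at_right_field)
  moreover have "\<forall>\<^sub>F u in nhds w. dist u w < d"
    using d(1) by (auto simp: eventually_nhds_metric)
  ultimately show "\<forall>\<^sub>F z in at_right (0::real) \<times>\<^sub>F nhds w. P z"
    unfolding eventually_prod_filter using d(2) by blast
qed

lemma le_subderivative_iff:
  "C \<le> subderivative f x w \<longleftrightarrow>
    (\<forall>c<C. \<exists>d>0. \<forall>t u. 0 < t \<and> t < d \<and> dist u w < d \<longrightarrow> c < diff_quotient f x t u)"
  by (simp add: subderivative_def le_Liminf_iff eventually_at_right_times_nhds)

lemma less_subderivativeD:
  assumes "c < subderivative f x w"
  obtains d where "d > 0" "\<And>t u. 0 < t \<Longrightarrow> t < d \<Longrightarrow> dist u w < d \<Longrightarrow> c < diff_quotient f x t u"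
  using assms le_subderivative_iff[of "subderivative f x w" f x w] by blast

lemma subderivative_lessD:
  assumes "subderivative f x w < C" "d > 0"
  obtains t u where "0 < t" "t < d" "dist u w < d" "diff_quotient f x t u < C"
proof (rule ccontr)
  assume "\<not> thesis"
  with that have n: "\<not> diff_quotient f x t u < C" if "0 < t" "t < d" "dist u w < d" for t u
    using that by blast
  have "C \<le> subderivative f x w"
    unfolding le_subderivative_iff using n assms(2) by (meson not_le order_less_le_trans)
  with assms(1) show False by order
qed

text \<open>
  A lower bound for the quotients that holds near \<open>w\<close> also holds near every \<open>u\<close> close to \<open>w\<close>. The
  intermediate level \<open>c'\<close> restores the strict inequality lost in the lower limit at \<open>u\<close>.
\<close>

lemma subderivative_lsc:
  fixes f :: "'a::real_normed_vector \<Rightarrow> ereal"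
  assumes "c < subderivative f x w"
  shows "\<forall>\<^sub>F u in nhds w. c < subderivative f x u"
proof -
  obtain c' where c': "c < c'" "c' < subderivative f x w" using dense[OF assms] by blast
  obtain d where d: "d > 0" "\<And>t u. 0 < t \<Longrightarrow> t < d \<Longrightarrow> dist u w < d \<Longrightarrow> c' < diff_quotient f x t u"
    using less_subderivativeD[OF c'(2)] by blast
  have "c < subderivative f x u" if u: "dist u w < d / 2" for u
  proof -
    have "c' < diff_quotient f x t y" if "0 < t" "t < d / 2" "dist y u < d / 2" for t y
      using d(2)[of t y] that u dist_triangle[of y w u] by auto
    then have "c' \<le> subderivative f x u"
      unfolding le_subderivative_iff using d(1) by (meson half_gt_zero order_less_trans)
    with c'(1) show ?thesis by order
  qed
  then show ?thesis
    using d(1) by (auto simp: eventually_nhds_metric intro!: exI[of _ "d / 2"])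
qed

lemma closed_epigraph_subderivative:
  fixes f :: "'a::real_normed_vector \<Rightarrow> ereal"
  shows "closed (ereal_epigraph (subderivative f x))"
proof -
  have "open (- ereal_epigraph (subderivative f x))"
  proof (subst open_subopen, intro ballI)
    fix p assume p: "p \<in> - ereal_epigraph (subderivative f x)"
    obtain w \<alpha> where wa: "p = (w, \<alpha>)" by (cases p)
    have "ereal \<alpha> < subderivative f x w" using p wa by (auto simp: ereal_epigraph_def not_le)
    then obtain \<beta> where b: "ereal \<alpha> < ereal \<beta>" "ereal \<beta> < subderivative f x w"
      using ereal_dense2 by blast
    from subderivative_lsc[OF b(2)] obtain U where
      U: "open U" "w \<in> U" "\<And>u. u \<in> U \<Longrightarrow> ereal \<beta> < subderivative f x u"
      by (auto simp: eventually_nhds)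
    have "U \<times> {..<\<beta>} \<subseteq> - ereal_epigraph (subderivative f x)"
    proof clarsimp
      fix u r assume "u \<in> U" "r < \<beta>" "(u, r) \<in> ereal_epigraph (subderivative f x)"
      then have "subderivative f x u \<le> ereal r" "ereal r < ereal \<beta>" "ereal \<beta> < subderivative f x u"
        using U(3) by (auto simp: ereal_epigraph_def)
      then show False by order
    qed
    moreover have "open (U \<times> {..<\<beta>})" using U(1) by (intro open_Times) auto
    moreover have "p \<in> U \<times> {..<\<beta>}" using wa U b by simp
    ultimately show "\<exists>T. open T \<and> p \<in> T \<and> T \<subseteq> - ereal_epigraph (subderivative f x)"
      by blast
  qed
  then show ?thesis by (simp add: closed_def)
qed

text \<open>
  Since \<open>t (s u) = (t s) u\<close>, the quotient in direction \<open>s u\<close> with step \<open>t\<close> is \<open>s\<close> times the quotient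
  in direction \<open>u\<close> with step \<open>t s\<close>. This gives one inequality for all \<open>s > 0\<close>; the other one is the
  same inequality for \<open>1 / s\<close> at \<open>s w\<close>.
\<close>

lemma subderivative_scaleR:
  fixes f :: "'a::real_normed_vector \<Rightarrow> ereal"
  assumes "s > 0"
  shows "subderivative f x (s *\<^sub>R w) = ereal s * subderivative f x w"
proof -
  have le: "ereal s * subderivative f x w \<le> subderivative f x (s *\<^sub>R w)" if s: "s > 0" for s w
    unfolding le_subderivative_iff
  proof (intro allI impI)
    fix c assume c: "c < ereal s * subderivative f x w"
    have "c / ereal s < subderivative f x w"
      using c s by (simp add: ereal_divide_less_pos mult.commute)
    then obtain d where d: "d > 0" "\<And>t u. 0 < t \<Longrightarrow> t < d \<Longrightarrow> dist u w < d \<Longrightarrow> c / ereal s < diff_quotient f x t u"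
      by (rule less_subderivativeD) blast
    have "c < diff_quotient f x t u" if t: "0 < t" "t < min (d / s) (d * s)" "dist u (s *\<^sub>R w) < min (d / s) (d * s)" for t u
    proof -
      have "dist ((1 / s) *\<^sub>R u) w = dist u (s *\<^sub>R w) / s"
      proof -
        have "(1 / s) *\<^sub>R u - w = (1 / s) *\<^sub>R (u - s *\<^sub>R w)" using s by (simp add: algebra_simps)
        then show ?thesis using s by (simp add: dist_norm)
      qed
      also have "\<dots> < d" using t s by (simp add: field_simps)
      finally have u: "dist ((1 / s) *\<^sub>R u) w < d" .
      have "c / ereal s < diff_quotient f x (t * s) ((1 / s) *\<^sub>R u)"
        using t s u by (intro d(2)) (auto simp: field_simps)
      also have "\<dots> = diff_quotient f x t u / ereal s"
        using s t(1) unfolding diff_quotient_def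
        by (cases "f (x + t *\<^sub>R u) - f x") (auto simp: field_simps)
      finally show ?thesis
        using s by (cases c; cases "diff_quotient f x t u") (auto simp: field_simps)
    qed
    then show "\<exists>d>0. \<forall>t u. 0 < t \<and> t < d \<and> dist u (s *\<^sub>R w) < d \<longrightarrow> c < diff_quotient f x t u"
      using d(1) s by (intro exI[of _ "min (d / s) (d * s)"]) auto
  qed
  have "ereal (1 / s) * subderivative f x (s *\<^sub>R w) \<le> subderivative f x w"
    using le[of "1 / s" "s *\<^sub>R w"] assms by simp
  then have "subderivative f x (s *\<^sub>R w) \<le> ereal s * subderivative f x w"
    using assms by (cases "subderivative f x (s *\<^sub>R w)"; cases "subderivative f x w")
      (auto simp: field_simps)
  with le[OF assms] show ?thesis by (rule antisym[rotated])
qed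

text \<open>
  The quotients in direction \<open>0\<close> vanish, which bounds the value by \<open>0\<close>, and homogeneity makes the
  value equal to its double.
\<close>

lemma subderivative_zero_cases:
  assumes "finite_at f x"
  shows "subderivative f x 0 = 0 \<or> subderivative f x 0 = -\<infinity>"
proof -
  have "\<not> 0 < subderivative f x 0"
  proof
    assume "0 < subderivative f x 0"
    then obtain d where d: "d > 0" "\<And>t u. 0 < t \<Longrightarrow> t < d \<Longrightarrow> dist u 0 < d \<Longrightarrow> 0 < diff_quotient f x t u"
      by (rule less_subderivativeD) blast
    have "0 < diff_quotient f x (d / 2) 0" using d by simp
    then show False using assms by (auto simp: diff_quotient_def finite_at_def)
  qed
  moreover have "subderivative f x 0 = ereal 2 * subderivative f x 0"
    using subderivative_scaleR[of 2 f x 0] by simp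
  ultimately show ?thesis by (cases "subderivative f x 0") auto
qed

text \<open>
  If \<open>h\<close> were \<open>-\<infinity>\<close> at some \<open>w\<close>, it would be \<open>-\<infinity>\<close> on the whole ray through \<open>w\<close>, and lower
  semicontinuity at the end of the ray would force \<open>h 0 = -\<infinity>\<close>.
\<close>

lemma proper_subderivative_iff:
  assumes "finite_at f x"
  shows "proper (subderivative f x) \<longleftrightarrow> subderivative f x 0 = 0"
proof
  assume "proper (subderivative f x)"
  then show "subderivative f x 0 = 0"
    using subderivative_zero_cases[OF assms] by (auto simp: proper_def)
next
  assume 0: "subderivative f x 0 = 0"
  have "subderivative f x w \<noteq> -\<infinity>" for w
  proof
    assume w: "subderivative f x w = -\<infinity>"
    have "\<forall>\<^sub>F u in nhds 0. -\<infinity> < subderivative f x u"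
      by (rule subderivative_lsc) (simp add: 0)
    then have "\<forall>\<^sub>F s in at_right 0. -\<infinity> < subderivative f x (s *\<^sub>R w)"
      by (rule eventually_compose_filterlim) (auto intro!: tendsto_eq_intros)
    moreover have "\<forall>\<^sub>F s in at_right 0. (0::real) < s" by (simp add: eventually_at_right_less)
    ultimately have "\<forall>\<^sub>F s::real in at_right 0. False"
      by eventually_elim (simp add: subderivative_scaleR w)
    then show False by simp
  qed
  moreover have "subderivative f x 0 \<noteq> \<infinity>" by (simp add: 0)
  ultimately show "proper (subderivative f x)" unfolding proper_def by blast
qed

text \<open>
  This is the part of epigraphical convergence that a minimization needs: lower bounds for the
  limit function hold for all quotients with small step, uniformly on compact sets. A finite
  cover by neighbourhoods on which the bound holds supplies a common step size.
\<close>

lemma uniform_lower_bound_on_compact: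
  fixes f :: "'a::real_normed_vector \<Rightarrow> ereal"
  assumes K: "compact K" and q: "continuous_on K q"
    and less: "\<And>u. u \<in> K \<Longrightarrow> ereal (q u) < subderivative f x u"
  obtains T where "T > 0" "\<And>t u. 0 < t \<Longrightarrow> t < T \<Longrightarrow> u \<in> K \<Longrightarrow> ereal (q u) < diff_quotient f x t u"
proof -
  have "\<exists>d>0. \<forall>t y. 0 < t \<and> t < d \<and> y \<in> K \<and> dist y u < d \<longrightarrow> ereal (q y) < diff_quotient f x t y"
    if u: "u \<in> K" for u
  proof -
    obtain s where s: "ereal (q u) < ereal s" "ereal s < subderivative f x u"
      using ereal_dense2[OF less[OF u]] by blast
    obtain d where d: "d > 0" "\<And>t y. 0 < t \<Longrightarrow> t < d \<Longrightarrow> dist y u < d \<Longrightarrow> ereal s < diff_quotient f x t y"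
      using less_subderivativeD[OF s(2)] by blast
    have "s - q u > 0" using s(1) by simp
    then obtain d' where d': "d' > 0" "\<And>y. y \<in> K \<Longrightarrow> dist y u < d' \<Longrightarrow> dist (q y) (q u) < s - q u"
      using q u unfolding continuous_on_iff by meson
    have "ereal (q y) < diff_quotient f x t y" if "0 < t" "t < min d d'" "y \<in> K" "dist y u < min d d'" for t y
    proof -
      have "ereal (q y) < ereal s" using d'(2)[of y] that by (auto simp: dist_real_def)
      moreover have "ereal s < diff_quotient f x t y" using d that by auto
      ultimately show ?thesis by order
    qed
    then show ?thesis using d d' by (intro exI[of _ "min d d'"]) auto
  qed
  then obtain d where d: "\<And>u. u \<in> K \<Longrightarrow> d u > 0"
    "\<And>u t y. \<lbrakk>u \<in> K; 0 < t; t < d u; y \<in> K; dist y u < d u\<rbrakk> \<Longrightarrow> ereal (q y) < diff_quotient f x t y"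
    by metis
  have cover: "K \<subseteq> (\<Union>u\<in>K. ball u (d u))" using d(1) by fastforce
  obtain D where D: "D \<subseteq> K" "finite D" "K \<subseteq> (\<Union>u\<in>D. ball u (d u))"
    using compactE_image[OF K _ cover] by auto
  define T where "T = Min (insert 1 (d ` D))"
  have "T > 0" using D d(1) by (auto simp: T_def)
  moreover have "ereal (q u) < diff_quotient f x t u" if t: "0 < t" "t < T" and u: "u \<in> K" for t u
  proof -
    obtain y where y: "y \<in> D" "dist u y < d y" using D(3) u by (auto simp: dist_commute)
    have "T \<le> d y" using y D(2) by (simp add: T_def)
    with y t u D(1) show ?thesis by (intro d(2)[of y]) auto
  qed
  ultimately show thesis using that by blast
qed

section \<open>Regular subgradients from penalized minimization\<close>

text \<open>
  Instead of an lsc function \<open>g\<close> the continuous function \<open>(u, \<alpha>) \<mapsto> \<alpha> + p u\<close> is minimized over a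
  truncation of the epigraph of \<open>g\<close>. Thus only the part of the epigraph at bounded heights has to
  be compact, which is all that local lower semicontinuity provides; points with values above the
  truncation level \<open>b\<close> cannot compete with \<open>u0\<close>.
\<close>

lemma attains_penalized_min:
  fixes g :: "'a::topological_space \<Rightarrow> ereal" and p :: "'a \<Rightarrow> real"
  assumes p: "continuous_on S p"
    and cpt: "compact (ereal_epigraph g \<inter> S \<times> {a..b})"
    and lower: "\<And>u. u \<in> S \<Longrightarrow> ereal a \<le> g u"
    and u0: "u0 \<in> S" and upper: "\<And>u. u \<in> S \<Longrightarrow> g u0 + ereal (p u0) \<le> ereal (b + p u)"
  obtains u where "u \<in> S" "finite_at g u" "\<And>y. y \<in> S \<Longrightarrow> g u + ereal (p u) \<le> g y + ereal (p y)"
proof -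
  let ?E = "ereal_epigraph g \<inter> S \<times> {a..b}"
  obtain c0 where c0: "g u0 = ereal c0" "a \<le> c0" "c0 \<le> b"
    using lower[OF u0] upper[OF u0] by (cases "g u0") auto
  have mem0: "(u0, c0) \<in> ?E" using c0 u0 by (auto simp: ereal_epigraph_def)
  have "continuous_on ?E (\<lambda>z. snd z + p (fst z))"
    by (intro continuous_intros continuous_on_compose2[OF p]) auto
  then obtain z where z: "z \<in> ?E" "\<And>y. y \<in> ?E \<Longrightarrow> snd z + p (fst z) \<le> snd y + p (fst y)"
    using continuous_attains_inf[OF cpt] mem0 by blast
  obtain u \<alpha> where ua: "z = (u, \<alpha>)" by (cases z)
  have u: "u \<in> S" "g u \<le> ereal \<alpha>" using z(1) by (auto simp: ua ereal_epigraph_def)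
  have min: "\<alpha> + p u \<le> \<beta> + p y" if "y \<in> S" "g y = ereal \<beta>" "\<beta> \<le> b" for y \<beta>
    using z(2)[of "(y, \<beta>)"] that lower[OF that(1)] by (auto simp: ua ereal_epigraph_def)
  have all: "ereal (\<alpha> + p u) \<le> g y + ereal (p y)" if y: "y \<in> S" for y
  proof (cases "g y \<le> ereal b")
    case True
    then obtain \<beta> where "g y = ereal \<beta>" using lower[OF y] by (cases "g y") auto
    with min[OF y this] True show ?thesis by simp
  next
    case False
    have "\<alpha> + p u \<le> c0 + p u0" using min[OF u0 c0(1) c0(3)] .
    also have "\<dots> \<le> b + p y" using upper[OF y] by (simp add: c0)
    finally show ?thesis using False by (cases "g y") auto
  qed
  obtain \<beta> where \<beta>: "g u = ereal \<beta>" using u lower[OF u(1)] by (cases "g u") auto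
  have "finite_at g u" by (simp add: finite_at_def \<beta>)
  moreover have "g u + ereal (p u) \<le> g y + ereal (p y)" if "y \<in> S" for y
    using all[OF that] u(2) by (cases "g y") (auto simp: \<beta>)
  ultimately show thesis using u(1) that by blast
qed

lemma regular_subgradient_at_penalized_min:
  fixes g :: "'a::real_inner \<Rightarrow> ereal" and p :: "'a \<Rightarrow> real"
  assumes fin: "finite_at g u" and min: "\<forall>\<^sub>F y in nhds u. g u + ereal (p u) \<le> g y + ereal (p y)"
    and p: "(p has_derivative (\<lambda>h. - (v \<bullet> h))) (at u)"
  shows "v \<in> regular_subdiff g u"
  unfolding regular_subdiff_iff
proof (intro conjI fin allI impI)
  fix e :: real assume e: "e > 0"
  obtain c where c: "g u = ereal c" using fin by (auto simp: finite_at_def)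
  have "\<forall>\<^sub>F y in nhds u. norm (p y - p u - - (v \<bullet> (y - u))) \<le> e * norm (y - u)"
    using p e unfolding has_derivative_at_alt eventually_nhds_metric dist_norm by meson
  with min show "\<forall>\<^sub>F y in nhds u. g u + ereal (v \<bullet> (y - u) - e * norm (y - u)) \<le> g y"
  proof eventually_elim
    case (elim y)
    then show ?case by (cases "g y") (auto simp: c)
  qed
qed

text \<open>
  With \<open>s = \<bar>u - w\<bar>\<close> and \<open>\<eta> = \<epsilon> \<rho> / 16\<close>, the penalty \<open>K s\<^sup>2\<close> with \<open>K = 2 \<epsilon> / \<rho>\<close> is chosen so that it
  dominates the error \<open>\<epsilon> s\<close> of the subgradient inequality once \<open>s > \<rho> / 2\<close>, with room for the
  errors \<open>\<eta>\<close>: a minimizer satisfies \<open>K s\<^sup>2 - \<epsilon> s \<le> 3 \<eta>\<close> and therefore lies at distance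
  \<open>s \<le> 3 \<rho> / 4\<close>, in the interior of the ball. The gradient of the penalty there has norm
  \<open>2 K s \<le> 3 \<epsilon>\<close>, independently of \<open>\<rho>\<close>. The squared norm serves as penalty because it is smooth,
  so no sum rule for subgradients is involved.
\<close>

lemma perturbed_regular_subgradient:
  fixes g :: "'a::euclidean_space \<Rightarrow> ereal"
  assumes \<rho>: "\<rho> > 0" and \<epsilon>: "\<epsilon> > 0"
    and lower: "\<And>u. u \<in> cball w \<rho> \<Longrightarrow>
        ereal (c + v \<bullet> (u - w) - \<epsilon> * norm (u - w) - \<epsilon> * \<rho> / 16) \<le> g u"
    and u0: "u0 \<in> cball w \<rho>" "g u0 \<le> ereal (c + \<epsilon> * \<rho> / 16)"
      "2 * \<epsilon> / \<rho> * (norm (u0 - w))\<^sup>2 - v \<bullet> (u0 - w) \<le> \<epsilon> * \<rho> / 16"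
    and cpt: "compact (ereal_epigraph g \<inter>
        cball w \<rho> \<times> {c - (norm v + 2 * \<epsilon>) * \<rho> .. c + (norm v + \<epsilon>) * \<rho>})"
  obtains u v' where "dist u w < \<rho>" "v' \<in> regular_subdiff g u" "dist v' v \<le> 3 * \<epsilon>"
    "ereal (c - (norm v + 2 * \<epsilon>) * \<rho>) \<le> g u" "g u \<le> ereal (c + (norm v + \<epsilon>) * \<rho>)"
proof -
  define p where "p u = 2 * \<epsilon> / \<rho> * ((u - w) \<bullet> (u - w)) - v \<bullet> (u - w)" for u
  have p_norm: "p u = 2 * \<epsilon> / \<rho> * (norm (u - w))\<^sup>2 - v \<bullet> (u - w)" for u
    by (simp add: p_def power2_norm_eq_inner)
  have inner: "\<bar>v \<bullet> (u - w)\<bar> \<le> norm v * \<rho>" and norm: "norm (u - w) \<le> \<rho>" if "u \<in> cball w \<rho>" for u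
  proof -
    show *: "norm (u - w) \<le> \<rho>" using that by (simp add: dist_norm norm_minus_commute)
    have "\<bar>v \<bullet> (u - w)\<bar> \<le> norm v * norm (u - w)" by (rule Cauchy_Schwarz_ineq2)
    also have "\<dots> \<le> norm v * \<rho>" using * by (intro mult_left_mono) auto
    finally show "\<bar>v \<bullet> (u - w)\<bar> \<le> norm v * \<rho>" .
  qed
  have p_ge: "- (norm v * \<rho>) \<le> p u" if "u \<in> cball w \<rho>" for u
    using inner[OF that] \<rho> \<epsilon> unfolding p_norm
    by (smt (verit) divide_nonneg_pos mult_nonneg_nonneg zero_le_power2)
  have \<epsilon>\<rho>: "\<epsilon> * \<rho> > 0" using \<rho> \<epsilon> by simp
  have start: "g u0 + ereal (p u0) \<le> ereal (c + \<epsilon> * \<rho> / 8)"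
  proof -
    have "g u0 + ereal (p u0) \<le> ereal (c + \<epsilon> * \<rho> / 16) + ereal (\<epsilon> * \<rho> / 16)"
      using u0 by (intro add_mono) (simp_all add: p_norm)
    then show ?thesis by (simp add: add.commute)
  qed
  have g_ge: "ereal (c - (norm v + 2 * \<epsilon>) * \<rho>) \<le> g u" if "u \<in> cball w \<rho>" for u
  proof -
    have "\<epsilon> * norm (u - w) \<le> \<epsilon> * \<rho>" using norm[OF that] \<epsilon> by simp
    then have "c - (norm v + 2 * \<epsilon>) * \<rho> \<le> c + v \<bullet> (u - w) - \<epsilon> * norm (u - w) - \<epsilon> * \<rho> / 16"
      using inner[OF that] \<epsilon>\<rho> by (simp add: algebra_simps)
    then show ?thesis using lower[OF that] by (metis ereal_less_eq(3) order_trans)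
  qed
  have cont: "continuous_on (cball w \<rho>) p" unfolding p_def by (intro continuous_intros)
  have high: "g u0 + ereal (p u0) \<le> ereal (c + (norm v + \<epsilon>) * \<rho> + p u)" if "u \<in> cball w \<rho>" for u
  proof -
    have "c + \<epsilon> * \<rho> / 8 \<le> c + (norm v + \<epsilon>) * \<rho> + p u"
      using p_ge[OF that] \<epsilon>\<rho> by (simp add: algebra_simps)
    with start show ?thesis by (metis ereal_less_eq(3) order_trans)
  qed
  obtain u where u: "u \<in> cball w \<rho>" "finite_at g u"
    "\<And>y. y \<in> cball w \<rho> \<Longrightarrow> g u + ereal (p u) \<le> g y + ereal (p y)"
    using attains_penalized_min[OF cont cpt g_ge u0(1) high] by blast
  obtain b where b: "g u = ereal b" using u(2) by (auto simp: finite_at_def)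
  define s where "s = norm (u - w)"
  have s: "0 \<le> s" "s \<le> \<rho>" using norm[OF u(1)] by (auto simp: s_def)
  have upper: "b + p u \<le> c + \<epsilon> * \<rho> / 8"
    using order_trans[OF u(3)[OF u0(1)] start] by (simp add: b)
  have "c + v \<bullet> (u - w) - \<epsilon> * s - \<epsilon> * \<rho> / 16 \<le> b"
    using lower[OF u(1)] by (simp add: b s_def)
  with upper have key: "2 * \<epsilon> / \<rho> * s\<^sup>2 - \<epsilon> * s \<le> 3 * (\<epsilon> * \<rho>) / 16"
    by (simp add: p_norm s_def)
  have s34: "s \<le> 3 / 4 * \<rho>"
  proof (rule ccontr)
    assume "\<not> ?thesis"
    then have gt: "3 / 4 * \<rho> < s" by simp
    have "3 / 8 * (\<epsilon> * \<rho>) = \<epsilon> * (3 / 4 * \<rho>) * (1 / 2)" by simp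
    also have "\<dots> \<le> \<epsilon> * s * (2 * s / \<rho> - 1)"
      using gt \<rho> \<epsilon> s by (intro mult_mono) (auto simp: field_simps)
    also have "\<dots> = 2 * \<epsilon> / \<rho> * s\<^sup>2 - \<epsilon> * s"
      using \<rho> by (simp add: field_simps power2_eq_square)
    also note key
    finally show False using \<epsilon>\<rho> by simp
  qed
  define v' where "v' = v - (4 * \<epsilon> / \<rho>) *\<^sub>R (u - w)"
  have "v' \<in> regular_subdiff g u"
  proof (rule regular_subgradient_at_penalized_min[OF u(2)])
    have "u \<in> ball w \<rho>" using s34 \<rho> by (simp add: s_def dist_norm norm_minus_commute)
    then have "\<forall>\<^sub>F y in nhds u. y \<in> ball w \<rho>" by (intro eventually_nhds_in_open) auto
    then show "\<forall>\<^sub>F y in nhds u. g u + ereal (p u) \<le> g y + ereal (p y)"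
      by eventually_elim (rule u(3), simp)
    show "(p has_derivative (\<lambda>h. - (v' \<bullet> h))) (at u)"
      unfolding p_def v'_def using \<rho>
      by (auto intro!: derivative_eq_intros simp: inner_commute algebra_simps fun_eq_iff)
  qed
  moreover have "dist v' v \<le> 3 * \<epsilon>"
  proof -
    have "dist v' v = 4 * \<epsilon> / \<rho> * s" using \<rho> \<epsilon> by (simp add: v'_def dist_norm s_def)
    also have "\<dots> \<le> 4 * \<epsilon> / \<rho> * (3 / 4 * \<rho>)" using s34 \<rho> \<epsilon> by (intro mult_left_mono) auto
    finally show ?thesis using \<rho> by simp
  qed
  moreover have "g u \<le> ereal (c + (norm v + \<epsilon>) * \<rho>)"
    using upper p_ge[OF u(1)] \<epsilon>\<rho> by (simp add: b algebra_simps)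
  moreover have "dist u w < \<rho>" using s34 \<rho> by (simp add: s_def dist_norm)
  ultimately show thesis using that g_ge[OF u(1)] by blast
qed


section \<open>Subgradients of the subderivative as limits of subgradients\<close>

text \<open>
  The map \<open>z \<mapsto> (x, f x) + t z\<close> carries the epigraph of the quotient to that of \<open>f\<close>, and for small \<open>t\<close>
  it carries a bounded set into the neighbourhood of \<open>(x, f x)\<close> in which the epigraph of \<open>f\<close> is
  closed.
\<close>

lemma compact_epigraph_diff_quotient:
  fixes f :: "'a::euclidean_space \<Rightarrow> ereal"
  assumes fin: "finite_at f x" and lsc: "locally_lsc_at f x" and S: "compact S"
  obtains T where "T > 0" "\<And>t. 0 < t \<Longrightarrow> t < T \<Longrightarrow> compact (ereal_epigraph (diff_quotient f x t) \<inter> S \<times> {a..b})"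
proof -
  obtain c where c: "f x = ereal c" using fin by (auto simp: finite_at_def)
  obtain V where V: "closed V" "(x, c) \<in> interior V" "closed (ereal_epigraph f \<inter> V)"
    using lsc by (auto simp: locally_lsc_at_def locally_closed_at_def c)
  obtain r where r: "r > 0" "ball (x, c) r \<subseteq> V" using V(2) by (auto simp: mem_interior)
  have "compact (S \<times> {a..b})" using S by (intro compact_Times) auto
  then obtain M where M: "M > 0" "\<And>z. z \<in> S \<times> {a..b} \<Longrightarrow> norm z \<le> M"
    using compact_imp_bounded bounded_pos by metis
  have "compact (ereal_epigraph (diff_quotient f x t) \<inter> S \<times> {a..b})" if t: "0 < t" "t < r / M" for t
  proof -
    let ?m = "\<lambda>z. (x, c) + t *\<^sub>R z"
    have in_V: "?m z \<in> V" if "z \<in> S \<times> {a..b}" for z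
    proof -
      have "t * norm z \<le> t * M" using M(2)[OF that] t by (intro mult_left_mono) auto
      also have "\<dots> < r" using t M(1) by (simp add: field_simps)
      finally have "dist (x, c) (?m z) < r" using t(1) by (simp add: dist_norm)
      then show ?thesis using r(2) by auto
    qed
    have "z \<in> ereal_epigraph (diff_quotient f x t) \<longleftrightarrow> ?m z \<in> ereal_epigraph f" for z
      using rescale_le_iff(1)[OF t(1), of "f (x + t *\<^sub>R fst z)" c "snd z"]
      by (cases z) (simp add: ereal_epigraph_def diff_quotient_def c)
    with in_V have "ereal_epigraph (diff_quotient f x t) \<inter> S \<times> {a..b}
        = ?m -` (ereal_epigraph f \<inter> V) \<inter> S \<times> {a..b}" by auto
    moreover have "closed (?m -` (ereal_epigraph f \<inter> V))"
      by (intro closed_vimage V(3) continuous_intros)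
    ultimately show ?thesis using \<open>compact (S \<times> {a..b})\<close> by (simp add: closed_Int_compact)
  qed
  moreover have "r / M > 0" using r(1) M(1) by simp
  ultimately show thesis using that by blast
qed

lemma regular_subdiff_subderivative_approx:
  fixes f :: "'a::euclidean_space \<Rightarrow> ereal"
  assumes fin: "finite_at f x" and lsc: "locally_lsc_at f x"
    and v: "v \<in> regular_subdiff (subderivative f x) w" and e: "e > 0"
  obtains t u v' where "0 < t" "t < e" "dist u w < e" "dist v' v < e"
    "v' \<in> regular_subdiff f (x + t *\<^sub>R u)"
    "subderivative f x w - ereal e < diff_quotient f x t u"
    "diff_quotient f x t u < subderivative f x w + ereal e"
proof -
  obtain a where a: "f x = ereal a" using fin by (auto simp: finite_at_def)
  obtain c where c: "subderivative f x w = ereal c"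
    using finite_at_regular_subdiff[OF v] by (auto simp: finite_at_def)
  \<comment> \<open>The slope error of the perturbed subgradient is \<open>3 \<epsilon> < e\<close>.\<close>
  define \<epsilon> where "\<epsilon> = e / 4"
  have \<epsilon>: "\<epsilon> > 0" using e by (simp add: \<epsilon>_def)
  obtain \<delta> where \<delta>: "\<delta> > 0"
    "\<And>y. dist y w < \<delta> \<Longrightarrow> ereal c + ereal (v \<bullet> (y - w) - \<epsilon> * norm (y - w)) \<le> subderivative f x y"
    using v \<epsilon> unfolding regular_subdiff_iff eventually_nhds_metric c by meson
  \<comment> \<open>The last bound keeps the values of the quotient at the minimizer within \<open>e\<close> of \<open>h w\<close>.\<close>
  define \<rho> where "\<rho> = min (\<delta> / 2) (min (e / 2) (e / (2 * (norm v + 2 * \<epsilon>))))"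
  have pos: "norm v + 2 * \<epsilon> > 0" using \<epsilon> by (simp add: add_nonneg_pos)
  have \<rho>: "\<rho> > 0" "\<rho> < \<delta>" "\<rho> < e" "\<rho> \<le> e / (2 * (norm v + 2 * \<epsilon>))"
  proof -
    show "\<rho> > 0" using \<delta>(1) e pos by (simp add: \<rho>_def)
    have "\<rho> \<le> \<delta> / 2" "\<rho> \<le> e / 2"
      unfolding \<rho>_def by (rule min.cobounded1, rule min.coboundedI2, rule min.cobounded1)
    then show "\<rho> < \<delta>" "\<rho> < e" using \<delta>(1) e by linarith+
    show "\<rho> \<le> e / (2 * (norm v + 2 * \<epsilon>))" by (simp add: \<rho>_def min_le_iff_disj)
  qed
  have range: "(norm v + 2 * \<epsilon>) * \<rho> < e" "(norm v + \<epsilon>) * \<rho> < e"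
  proof -
    have "(norm v + 2 * \<epsilon>) * \<rho> \<le> e / 2" using \<rho>(4) pos by (simp add: field_simps)
    then show *: "(norm v + 2 * \<epsilon>) * \<rho> < e" using e by simp
    have "(norm v + \<epsilon>) * \<rho> \<le> (norm v + 2 * \<epsilon>) * \<rho>" using \<rho>(1) \<epsilon> by (intro mult_right_mono) auto
    with * show "(norm v + \<epsilon>) * \<rho> < e" by simp
  qed
  have \<epsilon>\<rho>: "\<epsilon> * \<rho> > 0" using \<epsilon> \<rho> by simp
  define q where "q u = c + v \<bullet> (u - w) - \<epsilon> * norm (u - w) - \<epsilon> * \<rho> / 16" for u
  obtain T where T: "T > 0"
    "\<And>t u. 0 < t \<Longrightarrow> t < T \<Longrightarrow> u \<in> cball w \<rho> \<Longrightarrow> ereal (q u) < diff_quotient f x t u"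
  proof (rule uniform_lower_bound_on_compact[of "cball w \<rho>" q f x])
    show "continuous_on (cball w \<rho>) q" unfolding q_def by (intro continuous_intros)
    fix u assume "u \<in> cball w \<rho>"
    then have "dist u w < \<delta>" using \<rho>(2) by (simp add: dist_commute)
    from \<delta>(2)[OF this] have "ereal (q u + \<epsilon> * \<rho> / 16) \<le> subderivative f x u"
      by (simp add: q_def algebra_simps)
    moreover have "ereal (q u) < ereal (q u + \<epsilon> * \<rho> / 16)" using \<epsilon>\<rho> by simp
    ultimately show "ereal (q u) < subderivative f x u" by order
  qed auto
  obtain T' where T': "T' > 0" "\<And>t. 0 < t \<Longrightarrow> t < T' \<Longrightarrow>
      compact (ereal_epigraph (diff_quotient f x t) \<inter>
        cball w \<rho> \<times> {c - (norm v + 2 * \<epsilon>) * \<rho> .. c + (norm v + \<epsilon>) * \<rho>})"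
    using compact_epigraph_diff_quotient[OF fin lsc compact_cball] by blast
  have "((\<lambda>u. 2 * \<epsilon> / \<rho> * (norm (u - w))\<^sup>2 - v \<bullet> (u - w)) \<longlongrightarrow> 2 * \<epsilon> / \<rho> * (norm (w - w))\<^sup>2 - v \<bullet> (w - w)) (nhds w)"
    by (intro tendsto_intros filterlim_ident)
  then have "((\<lambda>u. 2 * \<epsilon> / \<rho> * (norm (u - w))\<^sup>2 - v \<bullet> (u - w)) \<longlongrightarrow> 0) (nhds w)" by simp
  from order_tendstoD(2)[OF this, of "\<epsilon> * \<rho> / 16"] \<epsilon>\<rho>
  obtain \<sigma> where \<sigma>: "\<sigma> > 0" "\<And>u. dist u w < \<sigma> \<Longrightarrow> 2 * \<epsilon> / \<rho> * (norm (u - w))\<^sup>2 - v \<bullet> (u - w) < \<epsilon> * \<rho> / 16"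
    by (auto simp: eventually_nhds_metric)
  define d where "d = min \<sigma> (min \<rho> (min T (min T' e)))"
  have d: "d > 0" "d \<le> \<sigma>" "d \<le> \<rho>" "d \<le> T" "d \<le> T'" "d \<le> e"
    using \<sigma>(1) \<rho>(1) T(1) T'(1) e by (auto simp: d_def)
  have "subderivative f x w < ereal (c + \<epsilon> * \<rho> / 16)" using \<epsilon>\<rho> by (simp add: c)
  then obtain t u0 where t: "0 < t" "t < d" and u0: "dist u0 w < d"
    "diff_quotient f x t u0 < ereal (c + \<epsilon> * \<rho> / 16)"
    using subderivative_lessD[OF _ d(1)] by blast
  obtain u v' where u: "dist u w < \<rho>" "v' \<in> regular_subdiff (diff_quotient f x t) u" "dist v' v \<le> 3 * \<epsilon>"
    "ereal (c - (norm v + 2 * \<epsilon>) * \<rho>) \<le> diff_quotient f x t u"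
    "diff_quotient f x t u \<le> ereal (c + (norm v + \<epsilon>) * \<rho>)"
  proof (rule perturbed_regular_subgradient[OF \<rho>(1) \<epsilon>, of w c v "diff_quotient f x t" u0])
    show "ereal (c + v \<bullet> (u - w) - \<epsilon> * norm (u - w) - \<epsilon> * \<rho> / 16) \<le> diff_quotient f x t u"
      if "u \<in> cball w \<rho>" for u
      using less_imp_le[OF T(2)[OF t(1) _ that]] t(2) d(4) by (simp add: q_def)
    show "u0 \<in> cball w \<rho>" using u0(1) d(3) by (simp add: dist_commute)
    show "diff_quotient f x t u0 \<le> ereal (c + \<epsilon> * \<rho> / 16)" using u0(2) by (rule less_imp_le)
    show "2 * \<epsilon> / \<rho> * (norm (u0 - w))\<^sup>2 - v \<bullet> (u0 - w) \<le> \<epsilon> * \<rho> / 16"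
      using \<sigma>(2)[of u0] u0(1) d(2) by simp
    show "compact (ereal_epigraph (diff_quotient f x t) \<inter>
        cball w \<rho> \<times> {c - (norm v + 2 * \<epsilon>) * \<rho> .. c + (norm v + \<epsilon>) * \<rho>})"
      using T'(2)[of t] t d(5) by simp
  qed
  show thesis
  proof (rule that[OF t(1)])
    show "t < e" "dist u w < e" "dist v' v < e" using t d u \<rho>(3) e by (auto simp: \<epsilon>_def)
    show "v' \<in> regular_subdiff f (x + t *\<^sub>R u)"
      by (rule regular_subdiff_rescale[OF _ t(1), of _ f x a])
        (use u(2) in \<open>simp add: diff_quotient_def[abs_def] a\<close>)
    have "ereal (c - e) < ereal (c - (norm v + 2 * \<epsilon>) * \<rho>)" using range by simp
    from order_less_le_trans[OF this u(4)]
    show "subderivative f x w - ereal e < diff_quotient f x t u" by (simp add: c)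
    have "ereal (c + (norm v + \<epsilon>) * \<rho>) < ereal (c + e)" using range by simp
    from order_le_less_trans[OF u(5) this]
    show "diff_quotient f x t u < subderivative f x w + ereal e" by (simp add: c)
  qed
qed

lemma regular_subdiff_subderivative_sequences:
  fixes f :: "'a::euclidean_space \<Rightarrow> ereal"
  assumes "finite_at f x" "locally_lsc_at f x" "v \<in> regular_subdiff (subderivative f x) w"
  shows "\<exists>(ts :: nat \<Rightarrow> real) (ws :: nat \<Rightarrow> 'a) (vs :: nat \<Rightarrow> 'a).
     (\<forall>l. ts l > 0) \<and> ts \<longlonglongrightarrow> 0 \<and> ws \<longlonglongrightarrow> w \<and> vs \<longlonglongrightarrow> v \<and>
     (\<forall>l. vs l \<in> regular_subdiff f (x + ts l *\<^sub>R ws l)) \<and>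
     (\<lambda>l. diff_quotient f x (ts l) (ws l)) \<longlonglongrightarrow> subderivative f x w"
proof -
  let ?P = "\<lambda>l t u v'. 0 < t \<and> t < 1 / real (Suc l) \<and> dist u w < 1 / real (Suc l) \<and>
      dist v' v < 1 / real (Suc l) \<and> v' \<in> regular_subdiff f (x + t *\<^sub>R u) \<and>
      subderivative f x w - ereal (1 / real (Suc l)) < diff_quotient f x t u \<and>
      diff_quotient f x t u < subderivative f x w + ereal (1 / real (Suc l))"
  have "\<exists>z. ?P l (fst z) (fst (snd z)) (snd (snd z))" for l
  proof -
    have "0 < 1 / real (Suc l)" by simp
    from regular_subdiff_subderivative_approx[OF assms this] obtain t u v' where "?P l t u v'"
      by blast
    then show ?thesis by (intro exI[of _ "(t, u, v')"]) simp
  qed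
  then obtain z where z: "\<And>l. ?P l (fst (z l)) (fst (snd (z l))) (snd (snd (z l)))" by metis
  define ts ws vs where "ts l = fst (z l)" and "ws l = fst (snd (z l))" and "vs l = snd (snd (z l))" for l
  have P: "?P l (ts l) (ws l) (vs l)" for l
    unfolding ts_def ws_def vs_def by (rule z)
  have "ts \<longlonglongrightarrow> 0"
    by (rule tendsto_dist_squeeze) (use P in \<open>simp add: dist_real_def abs_of_pos del: of_nat_Suc\<close>)
  moreover have "ws \<longlonglongrightarrow> w" by (rule tendsto_dist_squeeze) (use P in blast)
  moreover have "vs \<longlonglongrightarrow> v" by (rule tendsto_dist_squeeze) (use P in blast)
  moreover have "\<bar>subderivative f x w\<bar> \<noteq> \<infinity>"
    using finite_at_regular_subdiff[OF assms(3)] by (simp add: finite_at_def)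
  then have "(\<lambda>l. diff_quotient f x (ts l) (ws l)) \<longlonglongrightarrow> subderivative f x w"
    by (rule tendsto_ereal_squeeze) (use P in blast)+
  ultimately show ?thesis using P by (intro exI[of _ ts] exI[of _ ws] exI[of _ vs]) blast
qed

text \<open>A function that is homogeneous of degree one has constant slopes along rays.\<close>

lemma limiting_subdiff_subderivative_scaleR:
  fixes f :: "'a::real_inner \<Rightarrow> ereal"
  assumes v: "v \<in> limiting_subdiff (subderivative f x) w" and s: "s > 0"
  shows "v \<in> limiting_subdiff (subderivative f x) (s *\<^sub>R w)"
proof -
  let ?h = "subderivative f x"
  have reg: "q \<in> regular_subdiff ?h (s *\<^sub>R y)" if "q \<in> regular_subdiff ?h y" for q y
  proof -
    have "(\<lambda>u. (?h (0 + s *\<^sub>R u) - ereal 0) / ereal s) = ?h"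
    proof
      fix u show "(?h (0 + s *\<^sub>R u) - ereal 0) / ereal s = ?h u"
        using s by (cases "?h u") (simp_all add: subderivative_scaleR)
    qed
    with that have "q \<in> regular_subdiff (\<lambda>u. (?h (0 + s *\<^sub>R u) - ereal 0) / ereal s) y" by simp
    from regular_subdiff_rescale[OF this s] show ?thesis by simp
  qed
  obtain xs vs where xs: "xs \<longlonglongrightarrow> w" "vs \<longlonglongrightarrow> v" "(\<lambda>k. ?h (xs k)) \<longlonglongrightarrow> ?h w"
    "\<And>k. vs k \<in> regular_subdiff ?h (xs k)"
    using v by (auto simp: limiting_subdiff_def)
  have "(\<lambda>k. s *\<^sub>R xs k) \<longlonglongrightarrow> s *\<^sub>R w" using xs(1) by (intro tendsto_intros)
  moreover have "(\<lambda>k. ?h (s *\<^sub>R xs k)) \<longlonglongrightarrow> ?h (s *\<^sub>R w)"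
    unfolding subderivative_scaleR[OF s] using xs(3) by (intro tendsto_cmult_ereal) auto
  moreover have "finite_at ?h (s *\<^sub>R w)"
    using finite_at_limiting_subdiff[OF v] s by (cases "?h w") (auto simp: finite_at_def subderivative_scaleR)
  ultimately show ?thesis
    using xs(2) reg[OF xs(4)] unfolding limiting_subdiff_def by blast
qed

section \<open>Outer subgradients at the origin\<close>

text \<open>
  The quotient \<open>(f y - f x) / t\<close> at the approximating point \<open>y = x + t u\<close> is close to the positive
  number \<open>h w\<close>, so \<open>f y\<close> exceeds \<open>f x\<close>; it converges to \<open>f x\<close> because the quotient is bounded and \<open>t\<close>
  is small.
\<close>

lemma regular_subdiff_subset_outer_subdiff:
  fixes f :: "'a::euclidean_space \<Rightarrow> ereal"
  assumes fin: "finite_at f x" and lsc: "locally_lsc_at f x"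
    and v: "v \<in> regular_subdiff (subderivative f x) w" and pos: "0 < subderivative f x w"
  shows "v \<in> outer_subdiff f x"
  unfolding outer_subdiff_iff
proof (intro conjI fin allI impI)
  fix e :: real assume e: "e > 0"
  obtain a where a: "f x = ereal a" using fin by (auto simp: finite_at_def)
  obtain c where c: "subderivative f x w = ereal c"
    using finite_at_regular_subdiff[OF v] by (auto simp: finite_at_def)
  have "c > 0" using pos by (simp add: c)
  \<comment> \<open>In turn: the quotient stays positive and below \<open>2 c\<close>, \<open>t \<bar>u\<bar> < e\<close>, and \<open>t\<close> times the quotient is
    below \<open>e\<close>.\<close>
  define d where "d = min c (min (e / (norm w + e)) (min (e / (c + c)) e))"
  have d: "d > 0" "d \<le> c" "d \<le> e / (norm w + e)" "d \<le> e / (c + c)" "d \<le> e"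
    using e \<open>c > 0\<close> by (auto simp: d_def add_nonneg_pos)
  obtain t u v' where t: "0 < t" "t < d" and u: "dist u w < d" "dist v' v < d"
    "v' \<in> regular_subdiff f (x + t *\<^sub>R u)"
    "ereal c - ereal d < diff_quotient f x t u" "diff_quotient f x t u < ereal c + ereal d"
    using regular_subdiff_subderivative_approx[OF fin lsc v d(1)] unfolding c by blast
  obtain b where b: "f (x + t *\<^sub>R u) = ereal b"
    using finite_at_regular_subdiff[OF u(3)] by (auto simp: finite_at_def)
  have quot: "c - d < (b - a) / t" "(b - a) / t < c + d"
    using u(4,5) t(1) by (auto simp: diff_quotient_def a b)
  have "0 < (b - a) / t" using quot(1) d(2) by simp
  then have "a < b" using t(1) by (simp add: zero_less_divide_iff)
  moreover have "b < a + e"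
  proof -
    have "b - a < t * (c + d)" using quot(2) t(1) by (simp add: field_simps)
    also have "\<dots> \<le> e / (c + c) * (c + c)" using t d \<open>c > 0\<close> by (intro mult_mono) auto
    finally show ?thesis using \<open>c > 0\<close> by simp
  qed
  moreover have "dist (x + t *\<^sub>R u) x < e"
  proof -
    have "norm u < norm w + e" using u(1) d(5) norm_triangle_ineq2[of u w] by (simp add: dist_norm)
    then have "t * norm u < t * (norm w + e)" using t(1) by simp
    also have "\<dots> \<le> e / (norm w + e) * (norm w + e)" using t d e by (intro mult_right_mono) auto
    also have "\<dots> = e" using e norm_ge_zero[of w] by (smt (verit) nonzero_eq_divide_eq)
    finally show ?thesis using t(1) by (simp add: dist_norm)
  qed
  ultimately show "\<exists>y u. dist y x < e \<and> dist u v < e \<and> f x < f y \<and> f y < f x + ereal e \<and>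
      u \<in> regular_subdiff f y"
    using u(2,3) d(5) by (intro exI[of _ "x + t *\<^sub>R u"] exI[of _ v']) (auto simp: a b)
qed

text \<open>
  Penalized minimization of \<open>h\<close> itself, started at \<open>w\<close> with the trivial slope \<open>0\<close>. The radius \<open>\<rho>\<close> is
  dictated by the neighbourhood on which \<open>h > c / 2 > 0\<close>; the slope error \<open>\<epsilon>\<close>, which may be large
  here, is then chosen to turn \<open>c / 2\<close> into the lower bound that the perturbation lemma asks for.
\<close>

lemma exists_regular_subgradient_subderivative:
  fixes f :: "'a::euclidean_space \<Rightarrow> ereal"
  assumes pos: "0 < subderivative f x w" and fin: "subderivative f x w < \<infinity>"
  obtains u v where "0 < subderivative f x u" "v \<in> regular_subdiff (subderivative f x) u"
proof -
  let ?h = "subderivative f x"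
  obtain c where c: "?h w = ereal c" using pos fin by (cases "?h w") auto
  then have "c > 0" using pos by simp
  have "ereal (c / 2) < ?h w" using \<open>c > 0\<close> by (simp add: c)
  from subderivative_lsc[OF this] obtain \<delta> where
    \<delta>: "\<delta> > 0" "\<And>u. dist u w < \<delta> \<Longrightarrow> ereal (c / 2) < ?h u"
    by (auto simp: eventually_nhds_metric)
  define \<rho> where "\<rho> = \<delta> / 2"
  define \<epsilon> where "\<epsilon> = 8 * c / \<rho>"
  have \<rho>: "\<rho> > 0" "\<rho> < \<delta>" using \<delta>(1) by (auto simp: \<rho>_def)
  have \<epsilon>: "\<epsilon> > 0" "\<epsilon> * \<rho> / 16 = c / 2" using \<rho> \<open>c > 0\<close> by (auto simp: \<epsilon>_def)
  obtain u v where u: "dist u w < \<rho>" "v \<in> regular_subdiff ?h u"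
  proof (rule perturbed_regular_subgradient[OF \<rho>(1) \<epsilon>(1), of w c 0 ?h w])
    show "ereal (c + 0 \<bullet> (u - w) - \<epsilon> * norm (u - w) - \<epsilon> * \<rho> / 16) \<le> ?h u" if "u \<in> cball w \<rho>" for u
    proof -
      have "ereal (c + 0 \<bullet> (u - w) - \<epsilon> * norm (u - w) - \<epsilon> * \<rho> / 16) \<le> ereal (c / 2)"
        unfolding \<epsilon>(2) using \<epsilon>(1) by simp
      also have "\<dots> \<le> ?h u" using \<delta>(2)[of u] \<rho>(2) that by (simp add: dist_commute less_imp_le)
      finally show ?thesis .
    qed
    show "compact (ereal_epigraph ?h \<inter> cball w \<rho> \<times>
        {c - (norm (0::'a) + 2 * \<epsilon>) * \<rho>..c + (norm (0::'a) + \<epsilon>) * \<rho>})"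
      by (intro closed_Int_compact closed_epigraph_subderivative compact_Times compact_cball compact_Icc)
    show "2 * \<epsilon> / \<rho> * (norm (w - w))\<^sup>2 - 0 \<bullet> (w - w) \<le> \<epsilon> * \<rho> / 16" using \<epsilon>(1) \<rho>(1) by simp
    show "?h w \<le> ereal (c + \<epsilon> * \<rho> / 16)" using \<epsilon>(1) \<rho>(1) by (simp add: c)
    show "w \<in> cball w \<rho>" using \<rho>(1) by simp
  qed blast
  have "ereal (c / 2) < ?h u" using \<delta>(2)[of u] u(1) \<rho>(2) by simp
  moreover have "0 < ereal (c / 2)" using \<open>c > 0\<close> by simp
  ultimately have "0 < ?h u" by order
  with u(2) show thesis using that by blast
qed

text \<open>
  The function \<open>g\<close> stands for \<open>h\<close> if \<open>h 0 = 0\<close>, and for the positive part of \<open>h\<close> otherwise. The outer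
  subdifferential at \<open>0\<close> sees only points with \<open>g > 0\<close>, and near these points \<open>g\<close> agrees with \<open>h\<close>.
\<close>

lemma outer_subdiff_eq_closure_limiting_subdiff:
  fixes f g :: "'a::euclidean_space \<Rightarrow> ereal"
  assumes fin: "finite_at f x" and lsc: "locally_lsc_at f x"
    and W: "W = {w. 0 < subderivative f x w \<and> subderivative f x w < \<infinity>}"
    and g0: "g 0 = 0" and g_pos: "\<And>w. 0 < g w \<longleftrightarrow> 0 < subderivative f x w"
    and g_eq: "\<And>w. 0 < subderivative f x w \<Longrightarrow> \<forall>\<^sub>F u in nhds w. g u = subderivative f x u"
  shows "(\<forall>w \<in> W. limiting_subdiff (subderivative f x) w \<subseteq> outer_subdiff g 0 \<and>
            outer_subdiff g 0 \<subseteq> outer_subdiff f x) \<and>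
         outer_subdiff g 0 = closure (\<Union>w\<in>W. limiting_subdiff (subderivative f x) w) \<and>
         (outer_subdiff g 0 \<noteq> {} \<longleftrightarrow> W \<noteq> {})"
proof -
  let ?h = "subderivative f x"
  have fin0: "finite_at g 0" by (simp add: finite_at_def g0)
  have sub: "limiting_subdiff ?h w \<subseteq> outer_subdiff g 0" if w: "w \<in> W" for w
  proof
    fix v assume v: "v \<in> limiting_subdiff ?h w"
    obtain c where c: "?h w = ereal c" "c > 0" using w unfolding W by (cases "?h w") auto
    define s where "s k = 1 / real (Suc k)" for k
    have s: "s k > 0" for k by (simp add: s_def)
    have s_lim: "s \<longlonglongrightarrow> 0"
      unfolding s_def by (rule LIMSEQ_inverse_real_of_nat[unfolded inverse_eq_divide])
    have hs: "?h (s k *\<^sub>R w) = ereal (s k * c)" for k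
      using subderivative_scaleR[OF s, of f x k w] c by simp
    have ev: "\<forall>\<^sub>F u in nhds (s k *\<^sub>R w). g u = ?h u" for k
      by (rule g_eq) (use s[of k] c(2) in \<open>simp add: hs\<close>)
    have gs: "g (s k *\<^sub>R w) = ereal (s k * c)" for k
      using eventually_nhds_x_imp_x[OF ev] hs by simp
    have "(\<lambda>k. s k *\<^sub>R w) \<longlonglongrightarrow> 0 *\<^sub>R w" "(\<lambda>k. s k * c) \<longlonglongrightarrow> 0 * c"
      by (intro tendsto_intros s_lim)+
    then have "(\<lambda>k. s k *\<^sub>R w) \<longlonglongrightarrow> 0" "(\<lambda>k. g (s k *\<^sub>R w)) \<longlonglongrightarrow> g 0"
      unfolding gs g0 zero_ereal_def by simp_all
    moreover have "v \<in> limiting_subdiff g (s k *\<^sub>R w)" for k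
      using limiting_subdiff_subderivative_scaleR[OF v s] limiting_subdiff_cong[OF ev] by simp
    moreover have "g 0 < g (s k *\<^sub>R w)" for k
      using s[of k] c(2) by (simp add: gs g0)
    ultimately show "v \<in> outer_subdiff g 0"
      using fin0 tendsto_const[of v sequentially] unfolding outer_subdiff_def
      by (intro CollectI conjI exI[of _ "\<lambda>k. s k *\<^sub>R w"] exI[of _ "\<lambda>k. v"]) auto
  qed
  have reg_near: "\<exists>y u. y \<in> W \<and> dist u v < e \<and> u \<in> regular_subdiff ?h y"
    if v: "v \<in> outer_subdiff g 0" and e: "e > 0" for v e
  proof -
    from v e obtain y u where y: "dist u v < e" "g 0 < g y" "u \<in> regular_subdiff g y"
      unfolding outer_subdiff_iff by blast
    have pos: "0 < ?h y" using y(2) by (simp add: g0 g_pos)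
    have u: "u \<in> regular_subdiff ?h y" using y(3) regular_subdiff_cong[OF g_eq[OF pos]] by simp
    from finite_at_regular_subdiff[OF u] pos have "y \<in> W" by (auto simp: W finite_at_def)
    with y(1) u show ?thesis by blast
  qed
  have closure: "outer_subdiff g 0 = closure (\<Union>w\<in>W. limiting_subdiff ?h w)"
  proof
    show "outer_subdiff g 0 \<subseteq> closure (\<Union>w\<in>W. limiting_subdiff ?h w)"
    proof
      fix v assume v: "v \<in> outer_subdiff g 0"
      show "v \<in> closure (\<Union>w\<in>W. limiting_subdiff ?h w)"
        unfolding closure_approachable
      proof (intro allI impI)
        fix e :: real assume "e > 0"
        from reg_near[OF v this] show "\<exists>y\<in>\<Union>w\<in>W. limiting_subdiff ?h w. dist y v < e"
          using regular_subset_limiting by blast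
      qed
    qed
    show "closure (\<Union>w\<in>W. limiting_subdiff ?h w) \<subseteq> outer_subdiff g 0"
      using sub by (intro closure_minimal closed_outer_subdiff) blast
  qed
  have outer: "outer_subdiff g 0 \<subseteq> outer_subdiff f x"
  proof
    fix v assume v: "v \<in> outer_subdiff g 0"
    have "v \<in> closure (outer_subdiff f x)"
      unfolding closure_approachable
    proof (intro allI impI)
      fix e :: real assume "e > 0"
      from reg_near[OF v this] show "\<exists>y\<in>outer_subdiff f x. dist y v < e"
        using regular_subdiff_subset_outer_subdiff[OF fin lsc] unfolding W by blast
    qed
    then show "v \<in> outer_subdiff f x"
      by (simp add: closure_closed closed_outer_subdiff)
  qed
  have "outer_subdiff g 0 \<noteq> {} \<longleftrightarrow> W \<noteq> {}"
  proof
    assume "outer_subdiff g 0 \<noteq> {}"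
    then show "W \<noteq> {}" using closure by auto
  next
    assume "W \<noteq> {}"
    then obtain w where "0 < ?h w" "?h w < \<infinity>" by (auto simp: W)
    then obtain y u where y: "0 < ?h y" "u \<in> regular_subdiff ?h y"
      by (rule exists_regular_subgradient_subderivative)
    from finite_at_regular_subdiff[OF y(2)] y(1) have "y \<in> W" by (auto simp: W finite_at_def)
    with sub[OF this] y(2) regular_subset_limiting show "outer_subdiff g 0 \<noteq> {}" by blast
  qed
  with sub outer closure show ?thesis by blast
qed

theorem lemma3p1:
  fixes f h h_plus :: "real ^ 'n \<Rightarrow> ereal" and x :: "real ^ 'n" and W :: "(real ^ 'n) set"
  assumes "finite_at f x"
    and "locally_lsc_at f x"
    and "h = subderivative f x"
    and "W = {w. 0 < h w \<and> h w < \<infinity>}"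
    and "h_plus = (\<lambda>w. max (h w) 0)"
  shows "(\<forall>w. \<forall>v \<in> regular_subdiff h w.
           \<exists>(ts :: nat \<Rightarrow> real) (ws :: nat \<Rightarrow> real ^ 'n) (vs :: nat \<Rightarrow> real ^ 'n).
             (\<forall>l. ts l > 0) \<and> ts \<longlonglongrightarrow> 0 \<and> ws \<longlonglongrightarrow> w \<and> vs \<longlonglongrightarrow> v \<and>
             (\<forall>l. vs l \<in> regular_subdiff f (x + ts l *\<^sub>R ws l)) \<and>
             (\<lambda>l. diff_quotient f x (ts l) (ws l)) \<longlonglongrightarrow> h w)
    \<and> (proper h \<longleftrightarrow> h 0 = 0)
    \<and> (proper h \<longrightarrow>
           (\<forall>w \<in> W. limiting_subdiff h w \<subseteq> outer_subdiff h 0 \<and>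
                    outer_subdiff h 0 \<subseteq> outer_subdiff f x) \<and>
           outer_subdiff h 0 = closure (\<Union>w\<in>W. limiting_subdiff h w) \<and>
           (outer_subdiff h 0 \<noteq> {} \<longleftrightarrow> W \<noteq> {}))
    \<and> (\<not> proper h \<longleftrightarrow> h 0 = -\<infinity>)
    \<and> (\<not> proper h \<longrightarrow>
           (\<forall>w \<in> W. limiting_subdiff h w \<subseteq> outer_subdiff h_plus 0 \<and>
                    outer_subdiff h_plus 0 \<subseteq> outer_subdiff f x) \<and>
           outer_subdiff h_plus 0 = closure (\<Union>w\<in>W. limiting_subdiff h w) \<and>
           (outer_subdiff h_plus 0 \<noteq> {} \<longleftrightarrow> W \<noteq> {}))"
proof -
  let ?h = "subderivative f x"
  have fin: "finite_at f x" and lsc: "locally_lsc_at f x"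
    and W: "W = {w. 0 < ?h w \<and> ?h w < \<infinity>}" and hp: "h_plus = (\<lambda>w. max (?h w) 0)"
    using assms by simp_all
  have zero: "?h 0 = 0 \<or> ?h 0 = -\<infinity>" by (rule subderivative_zero_cases[OF fin])
  have proper: "proper ?h \<longleftrightarrow> ?h 0 = 0" by (rule proper_subderivative_iff[OF fin])
  have "h_plus 0 = 0" using zero by (auto simp: hp)
  moreover have "\<forall>\<^sub>F u in nhds w. h_plus u = ?h u" if "0 < ?h w" for w
    using subderivative_lsc[OF that] by eventually_elim (simp add: hp max_absorb1 less_imp_le)
  moreover have "0 < h_plus w \<longleftrightarrow> 0 < ?h w" for w by (simp add: hp less_max_iff_disj)
  ultimately have improper_case: "(\<forall>w \<in> W. limiting_subdiff ?h w \<subseteq> outer_subdiff h_plus 0 \<and>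
                    outer_subdiff h_plus 0 \<subseteq> outer_subdiff f x) \<and>
           outer_subdiff h_plus 0 = closure (\<Union>w\<in>W. limiting_subdiff ?h w) \<and>
           (outer_subdiff h_plus 0 \<noteq> {} \<longleftrightarrow> W \<noteq> {})"
    by (intro outer_subdiff_eq_closure_limiting_subdiff[OF fin lsc W])
  have proper_case: "(\<forall>w \<in> W. limiting_subdiff ?h w \<subseteq> outer_subdiff ?h 0 \<and>
                    outer_subdiff ?h 0 \<subseteq> outer_subdiff f x) \<and>
           outer_subdiff ?h 0 = closure (\<Union>w\<in>W. limiting_subdiff ?h w) \<and>
           (outer_subdiff ?h 0 \<noteq> {} \<longleftrightarrow> W \<noteq> {})" if "proper ?h"
    using that proper by (intro outer_subdiff_eq_closure_limiting_subdiff[OF fin lsc W]) auto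
  have "\<not> proper ?h \<longleftrightarrow> ?h 0 = -\<infinity>" using proper zero by auto
  with regular_subdiff_subderivative_sequences[OF fin lsc] proper proper_case improper_case
  show ?thesis unfolding assms(3) by blast
qed

end
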